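(* Let $S$ be a 1--signature and let $A$ be a set of soft $S$--inequations. Then the category of representations of $(S,A)$ has an initial object.
   Context: Let $\Delta:\mathbf{Set}\to\mathbf{PO}$ send a set $X$ to the preordered set $(X,=)$ (the smallest preorder); every function $X\to Y$ is then a monotone map $\Delta X\to\Delta Y$, and $\Delta$ is left adjoint to the forgetful functor $\mathbf{PO}\to\mathbf{Set}$. $\mathbf{PS}$ denotes the category whose objects are preordered sets and whose morphisms are arbitrary (not necessarily monotone) functions. Relative monads. For a functor $F:\mathcal C\to\mathcal D$, a (relative) monad $P$ on $F$ consists of a map on objects $P:\mathrm{Ob}\,\mathcal C\to\mathrm{Ob}\,\mathcal D$, morphisms $\eta_c\in\mathcal D(Fc,Pc)$, and maps $\sigma_{c,d}:\mathcal D(Fc,Pd)\to\mathcal D(Pc,Pd)$ such that $\sigma(f)\circ\eta_c=f$, $\sigma(\eta_c)=\mathrm{id}_{Pc}$ and $\sigma(g)\circ\sigma(f)=\sigma(\sigma(g)\circ f)$ for all suitable $f,g$. A morphism of monads $\tau:P\to Q$ on $F$ is a family $\tau_c\in\mathcal D(Pc,Qc)$ with $\tau_d\circ\sigma^P(f)=\sigma^Q(\tau_d\circ f)\circ\tau_c$ and $\tau_c\circ\eta^P_c=\eta^Q_c$. A module $M$ over $P$ with codomain a category $\mathcal E$ consists of a map on objects $M:\mathrm{Ob}\,\mathcal C\to\mathrm{Ob}\,\mathcal E$ and maps $\varsigma_{c,d}:\mathcal D(Fc,Pd)\to\mathcal E(Mc,Md)$ with $\varsigma(g)\circ\varsigma(f)=\varsigma(\sigma(g)\circ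 f)$ and $\varsigma(\eta_c)=\mathrm{id}$. A module morphism $\rho:M\to N$ is a family $\rho_c\in\mathcal E(Mc,Nc)$ with $\rho_d\circ\varsigma^M(f)=\varsigma^N(f)\circ\rho_c$. The tautological module $P$ over $P$ has object map $P$ and substitution $\sigma$. If $h:P\to Q$ is a monad morphism and $M$ a $Q$--module, the pullback $P$--module $h^*M$ has the same object map and substitution $\varsigma^{h^*M}(f)=\varsigma^M(h_d\circ f)$; this extends to module morphisms. The product of modules $M\times N$ has object map $c\mapsto Mc\times Nc$ and substitution $\varsigma^M(f)\times\varsigma^N(f)$. For a monad $P$ on $\Delta$, writing $V'=V+\{*\}$ and $i:W\to W'$ for the inclusion, the derived module $M'$ of a $P$--module $M$ has object map $V\mapsto M(V')$ and substitution $\varsigma^{M'}(f)=\varsigma^M(\mathrm{shift}(f))$, where $\mathrm{shift}(f):\Delta(V')\to P(W')$ sends $v\in V$ to $P(i)(f(v))$ and $*$ to $\eta_{W'}( * )$, with $P(i):=\sigma(\eta_{W'}\circ\Delta i)$. Derivation and products are functorial on module morphisms. $M^n$ denotes $M$ derived $n$ times and for a list $s=[n_1,\dots,n_m]$, $M^s:=M^{n_1}\times\dots\times M^{n_m}$ (similarly $\rho^s$ for morphisms). Signatures and representations. An arity is a finite list of natural numbers; a 1--signature is a family of arities. A representation $R$ of a 1--signature $S$ is a monad $R$ on $\Delta$ together with, for each arity $s\in S$, a morphism of $R$--modules with codomain $\mathbf{PO}$, $s^R:R^s\to R$ (with $R$ the tautological module). A morphism of representations $f:P\to Q$ is a monad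 morphism such that for every arity $s$ of $S$, $f\circ s^P=f^*(s^Q)\circ f^s$ as morphisms of $P$--modules $P^s\to f^*Q$. These form a category $\mathrm{Rep}^\Delta(S)$. $S$--modules and inequations. An $S$--module $U$ assigns to each representation $R$ of $S$ an $R$--module $U(R)$ with codomain $\mathbf{PS}$ and to each morphism of representations $f:P\to R$ a $P$--module morphism $U(f):U(P)\to f^*U(R)$, functorially. A half--equation $\alpha:U\to V$ between $S$--modules assigns to each representation $R$ an $R$--module morphism $\alpha^R:U(R)\to V(R)$ such that for every morphism of representations $f:P\to R$, $f^*(\alpha^R)\circ U(f)=V(f)\circ\alpha^P$. Algebraic $S$--modules are defined inductively: $R\mapsto\hat R$ (the tautological module $R$ regarded as a module with codomain $\mathbf{PS}$, acting on morphisms via the induced module morphisms) is algebraic; if $M$ is algebraic so is its pointwise derivative $R\mapsto M(R)'$; if $M,N$ are algebraic so is $R\mapsto M(R)\times N(R)$. An $S$--inequation $\alpha\le\gamma:U\to V$ is a pair of parallel half--equations; it is soft if its codomain $V$ is algebraic. A representation $R$ satisfies $\alpha\le\gamma$ if for every set $X$ and every $y\in U(R)(X)$, $\alpha^R_X(y)\le\gamma^R_X(y)$ in the preorder $V(R)(X)$. For a set $A$ of $S$--inequations, the category of representations of $(S,A)$ is the full subcategory of $\mathrm{Rep}^\Delta(S)$ on the representations satisfying every inequation of $A$. *)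

theory Defs
  imports "HOL-Library.FuncSet"
begin

section \<open>Categories and functors\<close>

text \<open>
  Hom-sets are not required to be disjoint, hence identities and composition carry an object:
  in \<open>cmp C a g f\<close> the object \<open>a\<close> is the domain of \<open>f\<close>.
\<close>

record ('o, 'm) cat =
  obj :: "'o set"
  hom :: "'o \<Rightarrow> 'o \<Rightarrow> 'm set"
  idn :: "'o \<Rightarrow> 'm"
  cmp :: "'o \<Rightarrow> 'm \<Rightarrow> 'm \<Rightarrow> 'm"

definition category :: "('o, 'm) cat \<Rightarrow> bool" where
  "category C \<longleftrightarrow>
     (\<forall>a\<in>obj C. idn C a \<in> hom C a a) \<and>
     (\<forall>a\<in>obj C. \<forall>b\<in>obj C. \<forall>c\<in>obj C. \<forall>f\<in>hom C a b. \<forall>g\<in>hom C b c. cmp C a g f \<in> hom C a c) \<and>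
     (\<forall>a\<in>obj C. \<forall>b\<in>obj C. \<forall>f\<in>hom C a b. cmp C a f (idn C a) = f \<and> cmp C a (idn C b) f = f) \<and>
     (\<forall>a\<in>obj C. \<forall>b\<in>obj C. \<forall>c\<in>obj C. \<forall>d\<in>obj C.
        \<forall>f\<in>hom C a b. \<forall>g\<in>hom C b c. \<forall>h\<in>hom C c d.
          cmp C a h (cmp C a g f) = cmp C a (cmp C b h g) f)"

record ('o, 'm, 'p, 'n) func =
  fob :: "'o \<Rightarrow> 'p"
  fmor :: "'o \<Rightarrow> 'o \<Rightarrow> 'm \<Rightarrow> 'n"

definition is_functor :: "('o, 'm) cat \<Rightarrow> ('p, 'n) cat \<Rightarrow> ('o, 'm, 'p, 'n) func \<Rightarrow> bool" where
  "is_functor C D F \<longleftrightarrow>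
     (\<forall>a\<in>obj C. fob F a \<in> obj D) \<and>
     (\<forall>a\<in>obj C. \<forall>b\<in>obj C. \<forall>f\<in>hom C a b. fmor F a b f \<in> hom D (fob F a) (fob F b)) \<and>
     (\<forall>a\<in>obj C. fmor F a a (idn C a) = idn D (fob F a)) \<and>
     (\<forall>a\<in>obj C. \<forall>b\<in>obj C. \<forall>c\<in>obj C. \<forall>f\<in>hom C a b. \<forall>g\<in>hom C b c.
        fmor F a c (cmp C a g f) = cmp D (fob F a) (fmor F b c g) (fmor F a b f))"

definition full_subcat :: "('o, 'm) cat \<Rightarrow> 'o set \<Rightarrow> ('o, 'm) cat" where
  "full_subcat C X = C\<lparr>obj := obj C \<inter> X\<rparr>"

definition initial_object :: "('o, 'm) cat \<Rightarrow> 'o \<Rightarrow> bool" where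
  "initial_object C a \<longleftrightarrow> a \<in> obj C \<and> (\<forall>b\<in>obj C. \<exists>!f. f \<in> hom C a b)"

section \<open>Relative monads and their modules\<close>

text \<open>
  All families are extensional (undefined off their index set), so that HOL equality of monads,
  modules and morphisms is the intended equality.
\<close>

record ('o, 'p, 'n) rmonad =
  mob :: "'o \<Rightarrow> 'p"
  munit :: "'o \<Rightarrow> 'n"
  msub :: "'o \<Rightarrow> 'o \<Rightarrow> 'n \<Rightarrow> 'n"

definition rel_monad ::
  "('o, 'm) cat \<Rightarrow> ('p, 'n) cat \<Rightarrow> ('o, 'm, 'p, 'n) func \<Rightarrow> ('o, 'p, 'n) rmonad \<Rightarrow> bool" where
  "rel_monad C D F P \<longleftrightarrow>
     mob P \<in> obj C \<rightarrow>\<^sub>E obj D \<and>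
     munit P \<in> (\<Pi>\<^sub>E c\<in>obj C. hom D (fob F c) (mob P c)) \<and>
     msub P \<in> (\<Pi>\<^sub>E c\<in>obj C. \<Pi>\<^sub>E d\<in>obj C.
                 hom D (fob F c) (mob P d) \<rightarrow>\<^sub>E hom D (mob P c) (mob P d)) \<and>
     (\<forall>c\<in>obj C. \<forall>d\<in>obj C. \<forall>f\<in>hom D (fob F c) (mob P d).
        cmp D (fob F c) (msub P c d f) (munit P c) = f) \<and>
     (\<forall>c\<in>obj C. msub P c c (munit P c) = idn D (mob P c)) \<and>
     (\<forall>c\<in>obj C. \<forall>d\<in>obj C. \<forall>e\<in>obj C.
        \<forall>f\<in>hom D (fob F c) (mob P d). \<forall>g\<in>hom D (fob F d) (mob P e).
          cmp D (mob P c) (msub P d e g) (msub P c d f)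
            = msub P c e (cmp D (fob F c) (msub P d e g) f))"

definition monad_mor ::
  "('o, 'm) cat \<Rightarrow> ('p, 'n) cat \<Rightarrow> ('o, 'm, 'p, 'n) func \<Rightarrow>
   ('o, 'p, 'n) rmonad \<Rightarrow> ('o, 'p, 'n) rmonad \<Rightarrow> ('o \<Rightarrow> 'n) \<Rightarrow> bool" where
  "monad_mor C D F P Q \<tau> \<longleftrightarrow>
     \<tau> \<in> (\<Pi>\<^sub>E c\<in>obj C. hom D (mob P c) (mob Q c)) \<and>
     (\<forall>c\<in>obj C. \<forall>d\<in>obj C. \<forall>f\<in>hom D (fob F c) (mob P d).
        cmp D (mob P c) (\<tau> d) (msub P c d f)
          = cmp D (mob P c) (msub Q c d (cmp D (fob F c) (\<tau> d) f)) (\<tau> c)) \<and>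
     (\<forall>c\<in>obj C. cmp D (fob F c) (\<tau> c) (munit P c) = munit Q c)"

record ('o, 'e, 'n, 'k) rmodule =
  modob :: "'o \<Rightarrow> 'e"
  modsub :: "'o \<Rightarrow> 'o \<Rightarrow> 'n \<Rightarrow> 'k"

definition rel_module ::
  "('o, 'm) cat \<Rightarrow> ('p, 'n) cat \<Rightarrow> ('o, 'm, 'p, 'n) func \<Rightarrow> ('o, 'p, 'n) rmonad \<Rightarrow>
   ('e, 'k) cat \<Rightarrow> ('o, 'e, 'n, 'k) rmodule \<Rightarrow> bool" where
  "rel_module C D F P E M \<longleftrightarrow>
     modob M \<in> obj C \<rightarrow>\<^sub>E obj E \<and>
     modsub M \<in> (\<Pi>\<^sub>E c\<in>obj C. \<Pi>\<^sub>E d\<in>obj C.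
                   hom D (fob F c) (mob P d) \<rightarrow>\<^sub>E hom E (modob M c) (modob M d)) \<and>
     (\<forall>c\<in>obj C. \<forall>d\<in>obj C. \<forall>e\<in>obj C.
        \<forall>f\<in>hom D (fob F c) (mob P d). \<forall>g\<in>hom D (fob F d) (mob P e).
          cmp E (modob M c) (modsub M d e g) (modsub M c d f)
            = modsub M c e (cmp D (fob F c) (msub P d e g) f)) \<and>
     (\<forall>c\<in>obj C. modsub M c c (munit P c) = idn E (modob M c))"

definition module_mor ::
  "('o, 'm) cat \<Rightarrow> ('p, 'n) cat \<Rightarrow> ('o, 'm, 'p, 'n) func \<Rightarrow> ('o, 'p, 'n) rmonad \<Rightarrow>
   ('e, 'k) cat \<Rightarrow> ('o, 'e, 'n, 'k) rmodule \<Rightarrow> ('o, 'e, 'n, 'k) rmodule \<Rightarrow> ('o \<Rightarrow> 'k) \<Rightarrow> bool" where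
  "module_mor C D F P E M N \<rho> \<longleftrightarrow>
     \<rho> \<in> (\<Pi>\<^sub>E c\<in>obj C. hom E (modob M c) (modob N c)) \<and>
     (\<forall>c\<in>obj C. \<forall>d\<in>obj C. \<forall>f\<in>hom D (fob F c) (mob P d).
        cmp E (modob M c) (\<rho> d) (modsub M c d f) = cmp E (modob M c) (modsub N c d f) (\<rho> c))"

definition module_idn :: "('o, 'm) cat \<Rightarrow> ('e, 'k) cat \<Rightarrow> ('o, 'e, 'n, 'k) rmodule \<Rightarrow> 'o \<Rightarrow> 'k" where
  "module_idn C E M = (\<lambda>c\<in>obj C. idn E (modob M c))"

definition module_cmp ::
  "('o, 'm) cat \<Rightarrow> ('e, 'k) cat \<Rightarrow> ('o, 'e, 'n, 'k) rmodule \<Rightarrow> ('o \<Rightarrow> 'k) \<Rightarrow> ('o \<Rightarrow> 'k) \<Rightarrow> 'o \<Rightarrow> 'k" where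
  "module_cmp C E M \<rho>' \<rho> = (\<lambda>c\<in>obj C. cmp E (modob M c) (\<rho>' c) (\<rho> c))"

definition taut_module :: "('o, 'p, 'n) rmonad \<Rightarrow> ('o, 'p, 'n, 'n) rmodule" where
  "taut_module P = \<lparr>modob = mob P, modsub = msub P\<rparr>"

text \<open>
  Pullback along a monad morphism \<open>h\<close> out of \<open>P\<close>. On module morphisms pullback leaves the
  underlying family unchanged, so it is not written there.
\<close>

definition pullback ::
  "('o, 'm) cat \<Rightarrow> ('p, 'n) cat \<Rightarrow> ('o, 'm, 'p, 'n) func \<Rightarrow> ('o, 'p, 'n) rmonad \<Rightarrow>
   ('o \<Rightarrow> 'n) \<Rightarrow> ('o, 'e, 'n, 'k) rmodule \<Rightarrow> ('o, 'e, 'n, 'k) rmodule" where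
  "pullback C D F P h M =
     \<lparr>modob = modob M,
      modsub = (\<lambda>c\<in>obj C. \<lambda>d\<in>obj C. \<lambda>f\<in>hom D (fob F c) (mob P d).
                  modsub M c d (cmp D (fob F c) (h d) f))\<rparr>"

section \<open>Sets, preordered sets and the functor \<open>\<Delta>\<close>\<close>

text \<open>
  HOL has no type of all sets. The category of sets is therefore taken relative to a universe \<open>U\<close>:
  a collection of subsets of an arbitrary type, closed under subsets, images and
  unions of families indexed by a member, and containing an infinite set. Closure under power
  sets is not required: the sets in a Grothendieck universe form one instance, all subsets of
  an infinite type form another.
\<close>

definition universe :: "'u set set \<Rightarrow> bool" where
  "universe U \<longleftrightarrow>
     (\<forall>X\<in>U. \<forall>Y. Y \<subseteq> X \<longrightarrow> Y \<in> U) \<and>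
     (\<forall>X\<in>U. \<forall>f. f ` X \<in> U) \<and>
     (\<forall>I\<in>U. \<forall>X. (\<forall>i\<in>I. X i \<in> U) \<longrightarrow> (\<Union>i\<in>I. X i) \<in> U) \<and>
     (\<exists>X\<in>U. infinite X)"

lemma universe_UNIV: "infinite (UNIV :: 'u set) \<Longrightarrow> universe (UNIV :: 'u set set)"
  by (auto simp: universe_def)

record 'u preord =
  car :: "'u set"
  ord :: "'u rel"

definition SET :: "'u set set \<Rightarrow> ('u set, 'u \<Rightarrow> 'u) cat" where
  "SET U = \<lparr>obj = U, hom = (\<lambda>X Y. X \<rightarrow>\<^sub>E Y), idn = (\<lambda>X. \<lambda>x\<in>X. x), cmp = compose\<rparr>"

definition PS :: "'u set set \<Rightarrow> ('u preord, 'u \<Rightarrow> 'u) cat" where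
  "PS U = \<lparr>obj = {p. car p \<in> U \<and> preorder_on (car p) (ord p)},
           hom = (\<lambda>p q. car p \<rightarrow>\<^sub>E car q),
           idn = (\<lambda>p. \<lambda>x\<in>car p. x),
           cmp = (\<lambda>p. compose (car p))\<rparr>"

definition PO :: "'u set set \<Rightarrow> ('u preord, 'u \<Rightarrow> 'u) cat" where
  "PO U = (PS U)\<lparr>hom := (\<lambda>p q. {f \<in> car p \<rightarrow>\<^sub>E car q. \<forall>(x, y)\<in>ord p. (f x, f y) \<in> ord q})\<rparr>"

definition Delta :: "('u set, 'u \<Rightarrow> 'u, 'u preord, 'u \<Rightarrow> 'u) func" where
  "Delta = \<lparr>fob = (\<lambda>X. \<lparr>car = X, ord = Id_on X\<rparr>), fmor = (\<lambda>X Y f. f)\<rparr>"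

lemma SET_simps:
  "obj (SET U) = U" "hom (SET U) X Y = X \<rightarrow>\<^sub>E Y" "idn (SET U) X = (\<lambda>x\<in>X. x)"
  "cmp (SET U) = compose"
  by (simp_all add: SET_def)

lemma PS_simps:
  "obj (PS U) = {p. car p \<in> U \<and> preorder_on (car p) (ord p)}"
  "hom (PS U) p q = car p \<rightarrow>\<^sub>E car q"
  "idn (PS U) p = (\<lambda>x\<in>car p. x)" "cmp (PS U) p = compose (car p)"
  by (simp_all add: PS_def)

lemma PO_simps:
  "obj (PO U) = {p. car p \<in> U \<and> preorder_on (car p) (ord p)}"
  "hom (PO U) p q = {f \<in> car p \<rightarrow>\<^sub>E car q. \<forall>(x, y)\<in>ord p. (f x, f y) \<in> ord q}"
  "idn (PO U) p = (\<lambda>x\<in>car p. x)" "cmp (PO U) p = compose (car p)"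
  by (simp_all add: PO_def PS_def)

lemma Delta_simps: "fob Delta X = \<lparr>car = X, ord = Id_on X\<rparr>" "fmor Delta X Y f = f"
  by (simp_all add: Delta_def)

lemma compose_restrict_id:
  "f \<in> A \<rightarrow>\<^sub>E B \<Longrightarrow> compose A (\<lambda>x\<in>B. x) f = f"
  "f \<in> A \<rightarrow>\<^sub>E B \<Longrightarrow> compose A f (\<lambda>x\<in>A. x) = f"
  by (auto simp: compose_def PiE_def extensional_def fun_eq_iff)

lemma compose_PiE: "f \<in> A \<rightarrow>\<^sub>E B \<Longrightarrow> g \<in> B \<rightarrow>\<^sub>E C \<Longrightarrow> compose A g f \<in> A \<rightarrow>\<^sub>E C"
  by (auto simp: compose_def PiE_def)

lemma compose_compose:
  "f \<in> A \<rightarrow>\<^sub>E B \<Longrightarrow> compose A h (compose A g f) = compose A (compose B h g) f"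
  by (auto simp: compose_def PiE_def fun_eq_iff)

lemma category_SET: "category (SET U)"
  unfolding category_def
  by (intro conjI ballI;
      simp add: SET_simps compose_restrict_id compose_PiE compose_compose del: PiE_iff)

lemma category_PS: "category (PS U)"
  unfolding category_def
  by (intro conjI ballI;
      simp add: PS_simps compose_restrict_id compose_PiE compose_compose del: PiE_iff)

lemma preorder_on_carrier: "preorder_on A r \<Longrightarrow> (x, y) \<in> r \<Longrightarrow> x \<in> A \<and> y \<in> A"
  by (auto simp: preorder_on_def)

lemma category_PO: "category (PO U)"
  unfolding category_def
  by (auto 4 4 simp: PO_simps compose_restrict_id compose_compose compose_def
      dest: preorder_on_carrier)

lemma is_functor_Delta: "is_functor (SET U) (PO U) Delta"
  by (auto simp: is_functor_def SET_simps PO_simps Delta_simps preorder_on_def refl_on_def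
      trans_def Id_on_def PiE_def)

type_synonym 'u monad = "('u set, 'u preord, 'u \<Rightarrow> 'u) rmonad"
type_synonym 'u module = "('u set, 'u preord, 'u \<Rightarrow> 'u, 'u \<Rightarrow> 'u) rmodule"
type_synonym 'u family = "'u set \<Rightarrow> 'u \<Rightarrow> 'u"

abbreviation monad_on_Delta :: "'u set set \<Rightarrow> 'u monad \<Rightarrow> bool" where
  "monad_on_Delta U \<equiv> rel_monad (SET U) (PO U) Delta"

abbreviation Delta_module ::
  "'u set set \<Rightarrow> 'u monad \<Rightarrow> ('u preord, 'u \<Rightarrow> 'u) cat \<Rightarrow> 'u module \<Rightarrow> bool" where
  "Delta_module U \<equiv> rel_module (SET U) (PO U) Delta"

abbreviation Delta_module_mor ::
  "'u set set \<Rightarrow> 'u monad \<Rightarrow> ('u preord, 'u \<Rightarrow> 'u) cat \<Rightarrow> 'u module \<Rightarrow> 'u module \<Rightarrow> 'u family \<Rightarrow> bool"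
  where "Delta_module_mor U \<equiv> module_mor (SET U) (PO U) Delta"

abbreviation Delta_pullback :: "'u set set \<Rightarrow> 'u monad \<Rightarrow> 'u family \<Rightarrow> 'u module \<Rightarrow> 'u module" where
  "Delta_pullback U \<equiv> pullback (SET U) (PO U) Delta"

section \<open>Derivation and products of modules\<close>

text \<open>
  A choice of an injective coding of finite tuples inside the universe; it realises
  \<open>V + {*}\<close> and finite products as sets of elements of the same type. Every universe lives
  on an infinite type, so \<open>tuple\<close> is injective there.
\<close>

definition tuple :: "'u list \<Rightarrow> 'u" where
  "tuple = (SOME t. inj t)"

definition untuple :: "'u \<Rightarrow> 'u list" where
  "untuple = inv tuple"

lemma inj_tuple:
  assumes "infinite (UNIV :: 'u set)"
  shows "inj (tuple :: 'u list \<Rightarrow> 'u)"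
proof -
  obtain p :: "'u \<times> 'u \<Rightarrow> 'u" where p: "inj p"
    using ordIso_imp_ordLeq[OF card_of_Times_same_infinite[OF assms]]
    unfolding card_of_ordLeq[symmetric] by auto
  obtain n :: "nat \<Rightarrow> 'u" where n: "inj n"
    using infinite_countable_subset[OF assms] by auto
  define e :: "'u list \<Rightarrow> 'u" where "e = rec_list undefined (\<lambda>x _ c. p (x, c))"
  have e: "xs = ys" if "length xs = length ys" "e xs = e ys" for xs ys
    using that by (induction rule: list_induct2) (auto simp: e_def dest: injD[OF p])
  have "inj (\<lambda>xs. p (n (length xs), e xs))"
    by (auto intro!: injI e dest!: injD[OF p] injD[OF n])
  then show ?thesis
    unfolding tuple_def by (rule someI[where P = inj])
qed

lemma universe_inj_tuple: "universe (U :: 'u set set) \<Longrightarrow> inj (tuple :: 'u list \<Rightarrow> 'u)"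
  by (rule inj_tuple) (auto simp: universe_def dest: finite_subset[OF subset_UNIV])

definition star :: 'u where
  "star = tuple []"

definition incl :: "'u \<Rightarrow> 'u" where
  "incl v = tuple [v]"

definition plus1 :: "'u set \<Rightarrow> 'u set" where
  "plus1 V = insert star (incl ` V)"

definition shift :: "'u set set \<Rightarrow> 'u monad \<Rightarrow> 'u set \<Rightarrow> 'u set \<Rightarrow> ('u \<Rightarrow> 'u) \<Rightarrow> 'u \<Rightarrow> 'u" where
  "shift U P V W f =
     (let i = restrict incl W;
          Pi_i = msub P W (plus1 W)
                   (cmp (PO U) (fob Delta W) (munit P (plus1 W)) (fmor Delta W (plus1 W) i))
      in (\<lambda>x\<in>plus1 V.
            if x = star then munit P (plus1 W) star else Pi_i (f (inv_into V incl x))))"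

definition deriv_module :: "'u set set \<Rightarrow> 'u monad \<Rightarrow> 'u module \<Rightarrow> 'u module" where
  "deriv_module U P M =
     \<lparr>modob = (\<lambda>V\<in>U. modob M (plus1 V)),
      modsub = (\<lambda>V\<in>U. \<lambda>W\<in>U. \<lambda>f\<in>hom (PO U) (fob Delta V) (mob P W).
                  modsub M (plus1 V) (plus1 W) (shift U P V W f))\<rparr>"

definition deriv_mor :: "'u set set \<Rightarrow> 'u family \<Rightarrow> 'u family" where
  "deriv_mor U \<rho> = (\<lambda>V\<in>U. \<rho> (plus1 V))"

definition preord_prod :: "'u preord list \<Rightarrow> 'u preord" where
  "preord_prod ps =
     \<lparr>car = tuple ` listset (map car ps),
      ord = {(tuple xs, tuple ys) | xs ys.
               length xs = length ps \<and> length ys = length ps \<and>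
               (\<forall>i<length ps. (xs ! i, ys ! i) \<in> ord (ps ! i))}\<rparr>"

definition fun_prod :: "'u preord list \<Rightarrow> ('u \<Rightarrow> 'u) list \<Rightarrow> 'u \<Rightarrow> 'u" where
  "fun_prod ps fs = (\<lambda>x\<in>car (preord_prod ps). tuple (map2 (\<lambda>f y. f y) fs (untuple x)))"

definition prod_module :: "'u set set \<Rightarrow> 'u monad \<Rightarrow> 'u module list \<Rightarrow> 'u module" where
  "prod_module U P Ms =
     \<lparr>modob = (\<lambda>V\<in>U. preord_prod (map (\<lambda>M. modob M V) Ms)),
      modsub = (\<lambda>V\<in>U. \<lambda>W\<in>U. \<lambda>f\<in>hom (PO U) (fob Delta V) (mob P W).
                  fun_prod (map (\<lambda>M. modob M V) Ms) (map (\<lambda>M. modsub M V W f) Ms))\<rparr>"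

text \<open>The list \<open>Ms\<close> consists of the domains of the morphisms in \<open>\<rho>s\<close>.\<close>

definition prod_mor :: "'u set set \<Rightarrow> 'u module list \<Rightarrow> 'u family list \<Rightarrow> 'u family" where
  "prod_mor U Ms \<rho>s = (\<lambda>V\<in>U. fun_prod (map (\<lambda>M. modob M V) Ms) (map (\<lambda>\<rho>. \<rho> V) \<rho>s))"

type_synonym arity = "nat list"

definition power_module :: "'u set set \<Rightarrow> 'u monad \<Rightarrow> arity \<Rightarrow> 'u module \<Rightarrow> 'u module" where
  "power_module U P s M = prod_module U P (map (\<lambda>n. (deriv_module U P ^^ n) M) s)"

definition power_mor :: "'u set set \<Rightarrow> 'u monad \<Rightarrow> arity \<Rightarrow> 'u module \<Rightarrow> 'u family \<Rightarrow> 'u family" where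
  "power_mor U P s M \<rho> =
     prod_mor U (map (\<lambda>n. (deriv_module U P ^^ n) M) s) (map (\<lambda>n. (deriv_mor U ^^ n) \<rho>) s)"

section \<open>Signatures and representations\<close>

record 'u sig =
  ops :: "'u set"
  ar :: "'u \<Rightarrow> arity"

definition signature :: "'u set set \<Rightarrow> 'u sig \<Rightarrow> bool" where
  "signature U S \<longleftrightarrow> ops S \<in> U"

record 'u rep =
  rmon :: "'u monad"
  rop :: "'u \<Rightarrow> 'u family"

definition representation :: "'u set set \<Rightarrow> 'u sig \<Rightarrow> 'u rep \<Rightarrow> bool" where
  "representation U S R \<longleftrightarrow>
     monad_on_Delta U (rmon R) \<and>
     rop R \<in> (\<Pi>\<^sub>E k\<in>ops S.
        {\<rho>. Delta_module_mor U (rmon R) (PO U)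
               (power_module U (rmon R) (ar S k) (taut_module (rmon R))) (taut_module (rmon R)) \<rho>})"

definition rep_mor :: "'u set set \<Rightarrow> 'u sig \<Rightarrow> 'u rep \<Rightarrow> 'u rep \<Rightarrow> 'u family \<Rightarrow> bool" where
  "rep_mor U S P Q f \<longleftrightarrow>
     monad_mor (SET U) (PO U) Delta (rmon P) (rmon Q) f \<and>
     (\<forall>k\<in>ops S.
        let T = taut_module (rmon P); Ts = power_module U (rmon P) (ar S k) T
        in module_cmp (SET U) (PO U) Ts f (rop P k)
             = module_cmp (SET U) (PO U) Ts (rop Q k) (power_mor U (rmon P) (ar S k) T f))"

definition REP :: "'u set set \<Rightarrow> 'u sig \<Rightarrow> ('u rep, 'u family) cat" where
  "REP U S =
     \<lparr>obj = {R. representation U S R},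
      hom = (\<lambda>P Q. {f. rep_mor U S P Q f}),
      idn = (\<lambda>P. module_idn (SET U) (PO U) (taut_module (rmon P))),
      cmp = (\<lambda>P. module_cmp (SET U) (PO U) (taut_module (rmon P)))\<rparr>"

section \<open>\<open>S\<close>-modules and inequations\<close>

record 'u smodule =
  smob :: "'u rep \<Rightarrow> 'u module"
  smmor :: "'u rep \<Rightarrow> 'u rep \<Rightarrow> 'u family \<Rightarrow> 'u family"

definition S_module :: "'u set set \<Rightarrow> 'u sig \<Rightarrow> 'u smodule \<Rightarrow> bool" where
  "S_module U S M \<longleftrightarrow>
     smob M \<in> (\<Pi>\<^sub>E R\<in>obj (REP U S). {N. Delta_module U (rmon R) (PS U) N}) \<and>
     smmor M \<in> (\<Pi>\<^sub>E P\<in>obj (REP U S). \<Pi>\<^sub>E R\<in>obj (REP U S). \<Pi>\<^sub>E f\<in>hom (REP U S) P R.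
        {\<rho>. Delta_module_mor U (rmon P) (PS U)
               (smob M P) (Delta_pullback U (rmon P) f (smob M R)) \<rho>}) \<and>
     (\<forall>R\<in>obj (REP U S).
        smmor M R R (idn (REP U S) R) = module_idn (SET U) (PS U) (smob M R)) \<and>
     (\<forall>P\<in>obj (REP U S). \<forall>Q\<in>obj (REP U S). \<forall>R\<in>obj (REP U S).
        \<forall>f\<in>hom (REP U S) P Q. \<forall>g\<in>hom (REP U S) Q R.
          smmor M P R (cmp (REP U S) P g f)
            = module_cmp (SET U) (PS U) (smob M P) (smmor M Q R g) (smmor M P Q f))"

definition half_equation ::
  "'u set set \<Rightarrow> 'u sig \<Rightarrow> 'u smodule \<Rightarrow> 'u smodule \<Rightarrow> ('u rep \<Rightarrow> 'u family) \<Rightarrow> bool" where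
  "half_equation U S M N \<alpha> \<longleftrightarrow>
     S_module U S M \<and> S_module U S N \<and>
     \<alpha> \<in> (\<Pi>\<^sub>E R\<in>obj (REP U S).
        {\<rho>. Delta_module_mor U (rmon R) (PS U) (smob M R) (smob N R) \<rho>}) \<and>
     (\<forall>P\<in>obj (REP U S). \<forall>R\<in>obj (REP U S). \<forall>f\<in>hom (REP U S) P R.
        module_cmp (SET U) (PS U) (smob M P) (\<alpha> R) (smmor M P R f)
          = module_cmp (SET U) (PS U) (smob M P) (smmor N P R f) (\<alpha> P))"

definition taut_smodule :: "'u set set \<Rightarrow> 'u sig \<Rightarrow> 'u smodule" where
  "taut_smodule U S =
     \<lparr>smob = (\<lambda>R\<in>obj (REP U S). taut_module (rmon R)),
      smmor = (\<lambda>P\<in>obj (REP U S). \<lambda>R\<in>obj (REP U S). \<lambda>f\<in>hom (REP U S) P R. f)\<rparr>"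

definition deriv_smodule :: "'u set set \<Rightarrow> 'u sig \<Rightarrow> 'u smodule \<Rightarrow> 'u smodule" where
  "deriv_smodule U S M =
     \<lparr>smob = (\<lambda>R\<in>obj (REP U S). deriv_module U (rmon R) (smob M R)),
      smmor = (\<lambda>P\<in>obj (REP U S). \<lambda>R\<in>obj (REP U S). \<lambda>f\<in>hom (REP U S) P R.
                 deriv_mor U (smmor M P R f))\<rparr>"

definition prod_smodule :: "'u set set \<Rightarrow> 'u sig \<Rightarrow> 'u smodule \<Rightarrow> 'u smodule \<Rightarrow> 'u smodule" where
  "prod_smodule U S M N =
     \<lparr>smob = (\<lambda>R\<in>obj (REP U S). prod_module U (rmon R) [smob M R, smob N R]),
      smmor = (\<lambda>P\<in>obj (REP U S). \<lambda>R\<in>obj (REP U S). \<lambda>f\<in>hom (REP U S) P R.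
                 prod_mor U [smob M P, smob N P] [smmor M P R f, smmor N P R f])\<rparr>"

inductive algebraic :: "'u set set \<Rightarrow> 'u sig \<Rightarrow> 'u smodule \<Rightarrow> bool" for U S where
  taut: "algebraic U S (taut_smodule U S)"
| deriv: "algebraic U S M \<Longrightarrow> algebraic U S (deriv_smodule U S M)"
| prod: "algebraic U S M \<Longrightarrow> algebraic U S N \<Longrightarrow> algebraic U S (prod_smodule U S M N)"

record 'u ineq =
  idom :: "'u smodule"
  icod :: "'u smodule"
  lhs :: "'u rep \<Rightarrow> 'u family"
  rhs :: "'u rep \<Rightarrow> 'u family"

definition inequation :: "'u set set \<Rightarrow> 'u sig \<Rightarrow> 'u ineq \<Rightarrow> bool" where
  "inequation U S a \<longleftrightarrow>
     half_equation U S (idom a) (icod a) (lhs a) \<and> half_equation U S (idom a) (icod a) (rhs a)"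

definition soft :: "'u set set \<Rightarrow> 'u sig \<Rightarrow> 'u ineq \<Rightarrow> bool" where
  "soft U S a \<longleftrightarrow> algebraic U S (icod a)"

definition satisfies :: "'u set set \<Rightarrow> 'u rep \<Rightarrow> 'u ineq \<Rightarrow> bool" where
  "satisfies U R a \<longleftrightarrow>
     (\<forall>X\<in>U. \<forall>y\<in>car (modob (smob (idom a) R) X).
        (lhs a R X y, rhs a R X y) \<in> ord (modob (smob (icod a) R) X))"

definition REP_ineq :: "'u set set \<Rightarrow> 'u sig \<Rightarrow> 'u ineq set \<Rightarrow> ('u rep, 'u family) cat" where
  "REP_ineq U S A = full_subcat (REP U S) {R. \<forall>a\<in>A. satisfies U R a}"

end

theory Submission
  imports Defs "HOL-Library.Countable_Set"
begin

text \<open>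
  The terms generated by \<open>S\<close>, with variables bound by passing from \<open>V\<close> to \<open>V + {*}\<close>, carry a monad
  structure given by substitution, and every representation \<open>R\<close> admits exactly one interpretation
  of terms compatible with variables, substitution and operations. Order the terms over \<open>V\<close> by
  \<open>s \<le> t\<close> iff the interpretations satisfy \<open>s \<le> t\<close> in every representation \<open>R\<close> of \<open>(S, A)\<close>. Substitution
  and the operations are monotone for this preorder because they are monotone in each \<open>R\<close>, so the
  terms form a representation, and the interpretations in representations of \<open>(S, A)\<close> become
  morphisms. For an algebraic module \<open>V\<close> the order on its value at the term representation is again
  detected by the maps induced by all these interpretations; by naturality of the half-equations
  the terms therefore satisfy the inequations of \<open>A\<close>, since every such \<open>R\<close> does.
\<close>

section \<open>Terms with binding\<close>

lemma list_all2_zipD: "list_all2 P xs ys \<Longrightarrow> (x, y) \<in> set (zip xs ys) \<Longrightarrow> P x y"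
  by (auto simp: list_all2_iff)

lemma list_all2_map2_right:
  "list_all2 (\<lambda>x y. P x (f x y)) xs ys \<Longrightarrow> list_all2 P xs (map2 f xs ys)"
  by (induction rule: list_all2_induct) auto

lemma map2_map2_right:
  "map2 g xs (map2 f xs ys) = map2 (\<lambda>x y. g x (f x y)) xs ys"
  by (induction xs arbitrary: ys; case_tac ys) auto

lemma map2_snd: "length xs = length ys \<Longrightarrow> map2 (\<lambda>x y. g y) xs ys = map g ys"
  by (induction rule: list_induct2) auto

lemma in_listset_iff: "xs \<in> listset As \<longleftrightarrow> list_all2 (\<in>) xs As"
  by (induction As arbitrary: xs) (auto simp: set_Cons_def list_all2_Cons2)

section \<open>Raw syntax, its operations and its coding\<close>

datatype 'u tm = Var 'u | Op 'u "'u tm list"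

text \<open>Scoping and arities are imposed by a predicate, because the arguments of a term over V
  live over the larger sets \<open>(plus1 ^^ n) V\<close>, which a HOL type cannot track.\<close>

inductive wf_tm :: "'u sig \<Rightarrow> 'u set \<Rightarrow> 'u tm \<Rightarrow> bool" for S where
  Var: "v \<in> V \<Longrightarrow> wf_tm S V (Var v)"
| Op: "k \<in> ops S \<Longrightarrow> list_all2 (\<lambda>n. wf_tm S ((plus1 ^^ n) V)) (ar S k) ts \<Longrightarrow> wf_tm S V (Op k ts)"

inductive_simps wf_tm_Var [simp]: "wf_tm S V (Var v)"
inductive_simps wf_tm_Op: "wf_tm S V (Op k ts)"

lemma size_zip_less [termination_simp]: "(n, t) \<in> set (zip ns ts) \<Longrightarrow> size t < Suc (size_list size ts)"
  by (metis set_zip_rightD size_list_estimation' le_imp_less_Suc order_refl)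

text \<open>
  At points other than \<open>star\<close> and outside the range of \<open>incl\<close> the two shifts below take junk
  values; the composition laws for substitution hold regardless, and only the identity law needs
  well-formed terms.
\<close>

definition ren_shift :: "('u \<Rightarrow> 'u) \<Rightarrow> 'u \<Rightarrow> 'u" where
  "ren_shift r x = (if x = star then star else incl (r (inv incl x)))"

text \<open>Renaming precedes substitution since \<open>tm_shift\<close> weakens the values of a
  substitution under a binder. Pairing with the arity by \<open>map2\<close> truncates ill-formed
  terms, but in the same way on both sides of the composition laws.\<close>

fun ren :: "'u sig \<Rightarrow> ('u \<Rightarrow> 'u) \<Rightarrow> 'u tm \<Rightarrow> 'u tm" where
  "ren S r (Var v) = Var (r v)"
| "ren S r (Op k ts) = Op k (map2 (\<lambda>n t. ren S ((ren_shift ^^ n) r) t) (ar S k) ts)"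

definition tm_shift :: "'u sig \<Rightarrow> ('u \<Rightarrow> 'u tm) \<Rightarrow> 'u \<Rightarrow> 'u tm" where
  "tm_shift S f x = (if x = star then Var star else ren S incl (f (inv incl x)))"

fun subst :: "'u sig \<Rightarrow> ('u \<Rightarrow> 'u tm) \<Rightarrow> 'u tm \<Rightarrow> 'u tm" where
  "subst S f (Var v) = f v"
| "subst S f (Op k ts) = Op k (map2 (\<lambda>n t. subst S ((tm_shift S ^^ n) f) t) (ar S k) ts)"

text \<open>The set V is carried along because units and operations of R are families over
  \<open>U\<close>; it grows with the variables bound in each argument.\<close>

fun interp :: "'u sig \<Rightarrow> 'u rep \<Rightarrow> 'u set \<Rightarrow> 'u tm \<Rightarrow> 'u" where
  "interp S R V (Var v) = munit (rmon R) V v"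
| "interp S R V (Op k ts) =
     rop R k V (tuple (map2 (\<lambda>n t. interp S R ((plus1 ^^ n) V) t) (ar S k) ts))"

text \<open>The second entry separates operations from variables.\<close>

fun enc :: "'u tm \<Rightarrow> 'u" where
  "enc (Var v) = tuple [v]"
| "enc (Op k ts) = tuple (k # star # map enc ts)"

locale binding_signature =
  fixes U :: "'u set set" and S :: "'u sig"
  assumes univ: "universe U" and sig: "signature U S"
begin

section \<open>Injectivity of the tuple coding\<close>

lemma tuple_eq_iff [simp]: "tuple (xs :: 'u list) = tuple ys \<longleftrightarrow> xs = ys"
  using universe_inj_tuple[OF univ] by (auto dest: injD)

lemma untuple_tuple [simp]: "untuple (tuple xs) = (xs :: 'u list)"
  by (simp add: untuple_def universe_inj_tuple[OF univ])

lemma incl_eq_iff [simp]: "incl (x :: 'u) = incl y \<longleftrightarrow> x = y"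
  by (simp add: incl_def)

lemma incl_neq_star [simp]: "incl (x :: 'u) \<noteq> star" "star \<noteq> incl (x :: 'u)"
  by (simp_all add: incl_def star_def)

lemma inv_incl [simp]: "inv incl (incl x) = (x :: 'u)"
  by (simp add: inj_on_def)

lemma inv_into_incl [simp]: "x \<in> V \<Longrightarrow> inv_into V incl (incl x) = (x :: 'u)"
  by (simp add: inj_on_def)

subsection \<open>Closure properties of the universe\<close>

lemma universe_subset: "X \<in> U \<Longrightarrow> Y \<subseteq> X \<Longrightarrow> Y \<in> U"
  and universe_image: "X \<in> U \<Longrightarrow> f ` X \<in> U"
  and universe_UN: "X \<in> U \<Longrightarrow> (\<And>i. i \<in> X \<Longrightarrow> Z i \<in> U) \<Longrightarrow> (\<Union>i\<in>X. Z i) \<in> U"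
  and infinite_member: "\<exists>X\<in>U. infinite X"
  using univ unfolding universe_def by simp_all

text \<open>An infinite member of \<open>U\<close> contains a copy of the natural numbers, and every
  nonempty countable set is an image of that copy.\<close>

lemma universe_countable:
  assumes "countable X"
  shows "X \<in> U"
proof (cases "X = {}")
  case True
  with infinite_member show ?thesis using universe_subset[of _ X] by blast
next
  case False
  obtain I where I: "I \<in> U" "infinite I" using infinite_member by blast
  obtain g :: "nat \<Rightarrow> 'u" where g: "inj g" "range g \<subseteq> I"
    using infinite_countable_subset[OF I(2)] by blast
  have "X = (from_nat_into X \<circ> inv g) ` range g"
    using range_from_nat_into[OF False assms] g(1) by (simp add: image_comp)
  moreover have "\<dots> \<in> U" by (rule universe_image[OF universe_subset[OF I(1) g(2)]])
  ultimately show ?thesis by simp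
qed

lemma universe_UN_countable:
  assumes "\<And>n :: nat. Y n \<in> U"
  shows "(\<Union>n. Y n) \<in> U"
proof -
  obtain g :: "nat \<Rightarrow> 'u" where g: "inj g"
    using infinite_member infinite_countable_subset by blast
  \<comment> \<open>Unions in \<open>U\<close> are indexed by members of \<open>U\<close>, so the
    natural numbers are replaced by an injective image of them.\<close>
  have "(\<Union>x\<in>range g. Y (inv g x)) \<in> U"
    by (rule universe_UN) (auto simp: assms universe_countable)
  then show ?thesis using g by simp
qed

lemma universe_Un:
  assumes "X \<in> U" "Y \<in> U"
  shows "X \<union> Y \<in> U"
proof -
  have "(\<Union>n :: nat. if n = 0 then X else Y) \<in> U"
    by (rule universe_UN_countable) (simp add: assms)
  then show ?thesis by (rule universe_subset) (auto split: if_splits)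
qed

lemma plus1_universe [simp]: "V \<in> U \<Longrightarrow> plus1 V \<in> U"
  using universe_Un[of "{star}" "incl ` V"]
  by (simp add: plus1_def universe_image universe_countable)

lemma plus1_pow_universe [simp]: "V \<in> U \<Longrightarrow> (plus1 ^^ n) V \<in> U"
  by (induction n) auto

text \<open>A product is the union, over the elements of its first factor, of images of the product
  of the other factors; closure under indexed unions and images therefore suffices.\<close>

lemma listset_universe: "list_all (\<lambda>X. X \<in> U) Xs \<Longrightarrow> tuple ` listset Xs \<in> U"
proof (induction Xs)
  case Nil
  then show ?case by (simp add: universe_countable)
next
  case (Cons X Xs)
  have "tuple ` listset (X # Xs) = (\<Union>x\<in>X. (\<lambda>y. tuple (x # untuple y)) ` tuple ` listset Xs)"
    by (auto simp: set_Cons_def image_iff)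
  then show ?case using Cons by (auto intro!: universe_UN universe_image)
qed

subsection \<open>Substitution\<close>

lemma ren_shift_simps [simp]:
  "ren_shift r star = (star :: 'u)" "ren_shift r (incl x) = incl (r (x :: 'u))"
  by (simp_all add: ren_shift_def)

lemma tm_shift_simps [simp]:
  "tm_shift S f star = Var (star :: 'u)" "tm_shift S f (incl x) = ren S incl (f (x :: 'u))"
  by (simp_all add: tm_shift_def)

section \<open>Fusion laws for renaming and substitution\<close>

lemma ren_shift_comp:
  "(ren_shift ^^ n) r' ((ren_shift ^^ n) r x) = (ren_shift ^^ n) (\<lambda>x. r' (r x)) (x :: 'u)"
proof (induction n arbitrary: x)
  case (Suc n)
  then show ?case by (simp add: ren_shift_def)
qed simp

text \<open>Each of the four fusion laws is an induction over terms resting on one law for iterated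
  shifts. The order matters: the shift laws behind \<open>ren_subst\<close> and
  \<open>subst_subst\<close> use the fusion laws proved before them.\<close>

lemma ren_ren: "ren S r' (ren S r t) = ren S (\<lambda>x. r' (r x)) (t :: 'u tm)"
proof (induction t arbitrary: r r')
  case (Op k ts)
  show ?case
    by (auto simp: map2_map2_right Op[OF set_zip_rightD] ren_shift_comp)
qed simp

lemma tm_shift_ren_shift:
  "(tm_shift S ^^ n) f ((ren_shift ^^ n) r x) = (tm_shift S ^^ n) (\<lambda>x. f (r x)) (x :: 'u)"
proof (induction n arbitrary: x)
  case (Suc n)
  then show ?case by (simp add: ren_shift_def tm_shift_def)
qed simp

lemma subst_ren: "subst S f (ren S r t) = subst S (\<lambda>x. f (r x)) (t :: 'u tm)"
proof (induction t arbitrary: r f)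
  case (Op k ts)
  show ?case
    by (auto simp: map2_map2_right Op[OF set_zip_rightD] tm_shift_ren_shift)
qed simp

lemma ren_shift_tm_shift:
  "ren S ((ren_shift ^^ n) r) ((tm_shift S ^^ n) f x) = (tm_shift S ^^ n) (\<lambda>x. ren S r (f x)) (x :: 'u)"
proof (induction n arbitrary: x)
  case (Suc n)
  have "ren S (ren_shift r) (tm_shift S f x) = tm_shift S (\<lambda>x. ren S r (f x)) x" for r f x
    by (simp add: tm_shift_def ren_ren)
  with Suc show ?case by simp
qed simp

lemma ren_subst: "ren S r (subst S f t) = subst S (\<lambda>x. ren S r (f x)) (t :: 'u tm)"
proof (induction t arbitrary: r f)
  case (Op k ts)
  show ?case
    by (auto simp: map2_map2_right Op[OF set_zip_rightD] ren_shift_tm_shift)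
qed simp

text \<open>Away from \<open>star\<close> both sides substitute the weakened values of g, by
  \<open>subst_ren\<close> on the left and \<open>ren_subst\<close> on the right.\<close>

lemma tm_shift_subst:
  "subst S ((tm_shift S ^^ n) g) ((tm_shift S ^^ n) f x) =
   (tm_shift S ^^ n) (\<lambda>x. subst S g (f x)) (x :: 'u)"
proof (induction n arbitrary: x)
  case (Suc n)
  have "subst S (tm_shift S g) (tm_shift S f x) = tm_shift S (\<lambda>x. subst S g (f x)) x" for g f x
    by (cases "x = star") (simp_all add: tm_shift_def[of S _ x] subst_ren ren_subst)
  with Suc show ?case by simp
qed simp

lemma subst_subst: "subst S g (subst S f t) = subst S (\<lambda>x. subst S g (f x)) (t :: 'u tm)"
proof (induction t arbitrary: g f)
  case (Op k ts)
  show ?case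
    by (auto simp: map2_map2_right Op[OF set_zip_rightD] tm_shift_subst)
qed simp

section \<open>Well-formed terms under renaming and substitution\<close>

lemma plus1_cases:
  assumes "x \<in> plus1 V"
  obtains "x = star" | v where "v \<in> V" "x = incl v"
  using assms by (auto simp: plus1_def)

lemma star_plus1 [simp]: "star \<in> plus1 V" and incl_plus1 [simp]: "incl v \<in> plus1 V \<longleftrightarrow> (v :: 'u) \<in> V"
  by (auto simp: plus1_def)

lemma ren_shift_wf: "r \<in> V \<rightarrow> W \<Longrightarrow> (ren_shift ^^ n) r \<in> (plus1 ^^ n) V \<rightarrow> (plus1 ^^ n) (W :: 'u set)"
  by (induction n) (auto elim!: plus1_cases)

lemma ren_wf: "wf_tm S V t \<Longrightarrow> r \<in> V \<rightarrow> W \<Longrightarrow> wf_tm S (W :: 'u set) (ren S r t)"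
proof (induction arbitrary: r W rule: wf_tm.induct)
  case (Op k V ts)
  show ?case
    by (auto simp: wf_tm_Op Op.hyps intro!: list_all2_map2_right list_all2_mono[OF Op.IH]
        ren_shift_wf Op.prems)
qed auto

lemma tm_shift_wf:
  "(\<And>v. v \<in> V \<Longrightarrow> wf_tm S W (f v)) \<Longrightarrow> v \<in> (plus1 ^^ n) V \<Longrightarrow>
   wf_tm S ((plus1 ^^ n) W) ((tm_shift S ^^ n) f (v :: 'u))"
  by (induction n arbitrary: v) (auto elim!: plus1_cases intro!: ren_wf)

lemma subst_wf:
  "wf_tm S V t \<Longrightarrow> (\<And>v. v \<in> V \<Longrightarrow> wf_tm S W (f v)) \<Longrightarrow> wf_tm S (W :: 'u set) (subst S f t)"
proof (induction arbitrary: f W rule: wf_tm.induct)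
  case (Op k V ts)
  show ?case
    by (auto simp: wf_tm_Op Op.hyps intro!: list_all2_map2_right list_all2_mono[OF Op.IH]
        tm_shift_wf Op.prems)
qed auto

lemma tm_shift_cong:
  "(\<And>v. v \<in> V \<Longrightarrow> f v = g v) \<Longrightarrow> v \<in> (plus1 ^^ n) V \<Longrightarrow>
   (tm_shift S ^^ n) f v = (tm_shift S ^^ n) g (v :: 'u)"
  by (induction n arbitrary: v) (auto elim!: plus1_cases)

text \<open>Only the values on V reach a well-formed term over V. This allows functions that are
  undefined off V to be compared with functions given by a formula.\<close>

lemma subst_cong:
  "wf_tm S V t \<Longrightarrow> (\<And>v. v \<in> V \<Longrightarrow> f v = g v) \<Longrightarrow> subst S f t = subst S g t"
proof (induction arbitrary: f g rule: wf_tm.induct)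
  case (Op k V ts)
  show ?case
    by (auto dest!: list_all2_zipD[OF Op.IH] simp: tm_shift_cong[of V f g, OF Op.prems])
qed auto

lemma tm_shift_Var: "v \<in> (plus1 ^^ n) V \<Longrightarrow> (tm_shift S ^^ n) Var v = Var (v :: 'u)"
  by (induction n arbitrary: v) (auto elim!: plus1_cases)

text \<open>Well-formedness enters twice: the iterated shift of \<open>Var\<close> is known to be
  \<open>Var\<close> only on \<open>(plus1 ^^ n) V\<close>, and \<open>map2\<close> keeps all
  arguments because their number matches the arity.\<close>

lemma subst_Var:
  "wf_tm S V t \<Longrightarrow> (\<And>v. v \<in> V \<Longrightarrow> f v = Var v) \<Longrightarrow> subst S f t = t"
proof (induction arbitrary: f rule: wf_tm.induct)
  case (Op k V ts)
  have "map2 (\<lambda>n. subst S ((tm_shift S ^^ n) f)) (ar S k) ts = map2 (\<lambda>_ t. t) (ar S k) ts"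
    by (auto dest!: list_all2_zipD[OF Op.IH]
        simp: tm_shift_cong[of V f Var, OF Op.prems] tm_shift_Var)
  also have "\<dots> = ts"
    using map2_snd[of "ar S k" ts "\<lambda>x. x"] list_all2_lengthD[OF Op.IH] by simp
  finally show ?case by simp
qed auto

text \<open>A shifted renaming, read as a substitution, is the shift of that substitution, even at
  junk points. The law later identifies the functorial action of the term monad with
  \<open>ren\<close>.\<close>

lemma ren_eq_subst: "ren S r t = subst S (\<lambda>x. Var (r x)) (t :: 'u tm)"
proof (induction t arbitrary: r)
  case (Op k ts)
  have "(tm_shift S ^^ n) (\<lambda>x. Var (r x)) = (\<lambda>x. Var ((ren_shift ^^ n) r x))" for n
  proof (induction n)
    case (Suc n)
    then show ?case by (auto simp: fun_eq_iff tm_shift_def ren_shift_def)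
  qed simp
  then show ?case by (auto simp: Op[OF set_zip_rightD])
qed simp

subsection \<open>The set of codes of terms belongs to the universe\<close>

lemma enc_eq_iff [simp]: "enc s = enc (t :: 'u tm) \<longleftrightarrow> s = t"
proof
  show "enc s = enc t \<Longrightarrow> s = t"
  proof (induction s arbitrary: t)
    case (Var v)
    then show ?case by (cases t) auto
  next
    case (Op k ss)
    then obtain ts where t: "t = Op k ts" "map enc ss = map enc ts" by (cases t) auto
    have "ss = ts"
      using t(2) by (intro nth_equalityI) (metis length_map, metis Op.IH length_map nth_map nth_mem)
    with t show ?case by simp
  qed
qed simp

definition dec :: "'u \<Rightarrow> 'u tm" where "dec = inv enc"

lemma dec_enc [simp]: "dec (enc t) = t"
  by (simp add: dec_def inj_on_def)

text \<open>Stratification by depth, with V varying in the recursion since arguments live over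
  larger sets. Membership in the universe can then be shown level by level and passed to the
  countable union.\<close>

primrec terms_upto :: "nat \<Rightarrow> 'u set \<Rightarrow> 'u tm set" where
  "terms_upto 0 V = {}"
| "terms_upto (Suc d) V = Var ` V \<union>
     (\<Union>k\<in>ops S. {Op k ts | ts. list_all2 (\<lambda>n t. t \<in> terms_upto d ((plus1 ^^ n) V)) (ar S k) ts})"

lemma enc_terms_upto_universe: "V \<in> U \<Longrightarrow> enc ` terms_upto d V \<in> U"
proof (induction d arbitrary: V)
  case (Suc d)
  \<comment> \<open>\<open>?X k\<close> holds the coded argument lists for k; prefixing
    \<open>k\<close> and \<open>star\<close> yields the codes of the terms headed by k.\<close>
  let ?X = "\<lambda>k. tuple ` listset (map (\<lambda>n. enc ` terms_upto d ((plus1 ^^ n) V)) (ar S k))"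
  have X: "?X k \<in> U" for k
    by (rule listset_universe) (simp add: list_all_iff Suc)
  have "enc ` terms_upto (Suc d) V \<subseteq>
    (\<lambda>v. tuple [v]) ` V \<union> (\<Union>k\<in>ops S. (\<lambda>x. tuple (k # star # untuple x)) ` ?X k)"
  proof
    fix x
    assume "x \<in> enc ` terms_upto (Suc d) V"
    then consider v where "v \<in> V" "x = tuple [v]"
      | k ts where "k \<in> ops S" "x = tuple (k # star # map enc ts)"
        "list_all2 (\<lambda>n t. t \<in> terms_upto d ((plus1 ^^ n) V)) (ar S k) ts"
      by auto
    then show "x \<in> (\<lambda>v. tuple [v]) ` V \<union> (\<Union>k\<in>ops S. (\<lambda>x. tuple (k # star # untuple x)) ` ?X k)"
    proof cases
      case 2
      have "tuple (map enc ts) \<in> ?X k"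
        using 2(3) by (auto simp: in_listset_iff list_all2_conv_all_nth)
      moreover have "x = tuple (k # star # untuple (tuple (map enc ts)))" by (simp add: 2)
      ultimately show ?thesis using 2(1) by blast
    qed simp
  qed
  moreover have "(\<lambda>v. tuple [v]) ` V \<union> (\<Union>k\<in>ops S. (\<lambda>x. tuple (k # star # untuple x)) ` ?X k) \<in> U"
    using Suc.prems sig X
    by (intro universe_Un universe_UN universe_image) (auto simp: signature_def)
  ultimately show ?case by (rule universe_subset[rotated])
qed (simp add: universe_countable)

declare enc.simps [simp del]

lemma terms_upto_mono: "d \<le> d' \<Longrightarrow> terms_upto d V \<subseteq> terms_upto d' V"
proof (induction d arbitrary: d' V)
  case (Suc d)
  obtain e where e: "d' = Suc e" "d \<le> e" using Suc.prems by (cases d') auto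
  have "list_all2 (\<lambda>n t. t \<in> terms_upto e ((plus1 ^^ n) V)) ns ts"
    if "list_all2 (\<lambda>n t. t \<in> terms_upto d ((plus1 ^^ n) V)) ns ts" for ns ts
    using list_all2_mono[OF that] Suc.IH[OF e(2)] by (simp add: subset_iff)
  then show ?case by (auto simp: e)
qed simp

text \<open>A term has finitely many arguments, so the maximum of their levels serves for all of
  them, and the term itself occurs one level higher.\<close>

lemma wf_tm_terms_upto: "wf_tm S V t \<Longrightarrow> \<exists>d. t \<in> terms_upto d V"
proof (induction rule: wf_tm.induct)
  case (Var v V)
  then have "Var v \<in> terms_upto (Suc 0) V" by simp
  then show ?case ..
next
  case (Op k V ts)
  have "\<exists>d. list_all2 (\<lambda>n t. t \<in> terms_upto d ((plus1 ^^ n) V)) ns ts"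
    if "list_all2 (\<lambda>n t. \<exists>d. t \<in> terms_upto d ((plus1 ^^ n) V)) ns ts" for ns ts
    using that
  proof (induction rule: list_all2_induct)
    case (Cons n ns t ts)
    then obtain d e where "t \<in> terms_upto d ((plus1 ^^ n) V)"
      "list_all2 (\<lambda>n t. t \<in> terms_upto e ((plus1 ^^ n) V)) ns ts" by blast
    then have "t \<in> terms_upto (max d e) ((plus1 ^^ n) V)"
      "list_all2 (\<lambda>n t. t \<in> terms_upto (max d e) ((plus1 ^^ n) V)) ns ts"
      using terms_upto_mono[of d "max d e"] terms_upto_mono[of e "max d e"]
      by (force simp: list_all2_conv_all_nth)+
    then show ?case by auto
  qed simp
  moreover have "list_all2 (\<lambda>n t. \<exists>d. t \<in> terms_upto d ((plus1 ^^ n) V)) (ar S k) ts"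
    using Op.IH by (rule list_all2_mono) simp
  ultimately obtain d where "list_all2 (\<lambda>n t. t \<in> terms_upto d ((plus1 ^^ n) V)) (ar S k) ts" by blast
  then have "Op k ts \<in> terms_upto (Suc d) V" using Op.hyps by auto
  then show ?case ..
qed

definition terms :: "'u set \<Rightarrow> 'u set" where
  "terms V = enc ` Collect (wf_tm S V)"

lemma terms_universe: "V \<in> U \<Longrightarrow> terms V \<in> U"
  by (rule universe_subset[OF universe_UN_countable[OF enc_terms_upto_universe]])
     (auto simp: terms_def dest!: wf_tm_terms_upto)

lemma enc_terms_iff [simp]: "enc t \<in> terms V \<longleftrightarrow> wf_tm S V t"
  by (auto simp: terms_def)

lemma dec_terms: "x \<in> terms V \<Longrightarrow> wf_tm S V (dec x) \<and> enc (dec x) = x"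
  by (auto simp: terms_def)

section \<open>Representations elementwise\<close>

text \<open>This is the adjunction between \<open>Delta\<close> and the forgetful functor: on a
  discrete preorder, monotonicity only asks for reflexivity of the target.\<close>

lemma hom_Delta:
  "preorder_on (car p) (ord p) \<Longrightarrow> hom (PO U) (fob Delta V) p = V \<rightarrow>\<^sub>E car p"
  by (auto simp: PO_simps Delta_simps preorder_on_def refl_on_def)

section \<open>Elementwise laws of a monad on \<Delta>\<close>

context
  fixes P :: "'u monad"
  assumes monad: "monad_on_Delta U P"
begin

lemma monad_preorder: "V \<in> U \<Longrightarrow> preorder_on (car (mob P V)) (ord (mob P V))"
  using monad by (auto simp: rel_monad_def SET_simps PO_simps PiE_iff)

lemma monad_hom: "W \<in> U \<Longrightarrow> hom (PO U) (fob Delta V) (mob P W) = V \<rightarrow>\<^sub>E car (mob P W)"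
  by (simp add: hom_Delta monad_preorder)

lemma monad_unit: "V \<in> U \<Longrightarrow> munit P V \<in> V \<rightarrow>\<^sub>E car (mob P V)"
  using monad unfolding rel_monad_def SET_simps by (auto simp: PiE_iff monad_hom)

lemma monad_sub:
  assumes "V \<in> U" "W \<in> U" "f \<in> V \<rightarrow>\<^sub>E car (mob P W)"
  shows "msub P V W f \<in> hom (PO U) (mob P V) (mob P W)"
proof -
  have "msub P \<in> (\<Pi>\<^sub>E c\<in>U. \<Pi>\<^sub>E d\<in>U. hom (PO U) (fob Delta c) (mob P d) \<rightarrow>\<^sub>E hom (PO U) (mob P c) (mob P d))"
    using monad unfolding rel_monad_def SET_simps by blast
  then have "msub P V W \<in> hom (PO U) (fob Delta V) (mob P W) \<rightarrow>\<^sub>E hom (PO U) (mob P V) (mob P W)"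
    using assms by blast
  then show ?thesis using assms monad_hom by blast
qed

lemma monad_sub_car:
  "V \<in> U \<Longrightarrow> W \<in> U \<Longrightarrow> f \<in> V \<rightarrow>\<^sub>E car (mob P W) \<Longrightarrow> x \<in> car (mob P V) \<Longrightarrow>
   msub P V W f x \<in> car (mob P W)"
  using monad_sub unfolding PO_simps by blast

lemma monad_sub_mono:
  "V \<in> U \<Longrightarrow> W \<in> U \<Longrightarrow> f \<in> V \<rightarrow>\<^sub>E car (mob P W) \<Longrightarrow> (x, y) \<in> ord (mob P V) \<Longrightarrow>
   (msub P V W f x, msub P V W f y) \<in> ord (mob P W)"
  using monad_sub unfolding PO_simps by blast

lemma monad_sub_unit:
  assumes "V \<in> U" "W \<in> U" "f \<in> V \<rightarrow>\<^sub>E car (mob P W)" "v \<in> V"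
  shows "msub P V W f (munit P V v) = f v"
proof -
  have "cmp (PO U) (fob Delta V) (msub P V W f) (munit P V) = f"
    using monad assms unfolding rel_monad_def SET_simps by (simp add: monad_hom)
  from fun_cong[OF this, of v] show ?thesis
    using assms by (simp add: PO_simps Delta_simps compose_eq)
qed

text \<open>The functorial action of the inclusion is substitution by the variables
  \<open>incl w\<close>, since \<open>Delta\<close> leaves functions unchanged.\<close>

lemma shift_eq:
  assumes "V \<in> U" "W \<in> U"
  shows "shift U P V W f = (\<lambda>x\<in>plus1 V. if x = star then munit P (plus1 W) star else
    msub P W (plus1 W) (\<lambda>w\<in>W. munit P (plus1 W) (incl w)) (f (inv_into V incl x)))"
  by (auto simp: shift_def Let_def PO_simps Delta_simps compose_def fun_eq_iff cong: restrict_cong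
      intro!: arg_cong[where f = "\<lambda>h. msub P W (plus1 W) h _"])

lemma incl_unit:
  "W \<in> U \<Longrightarrow> (\<lambda>w\<in>W. munit P (plus1 W) (incl w)) \<in> W \<rightarrow>\<^sub>E car (mob P (plus1 W))"
  using monad_unit[of "plus1 W"] by auto

lemma shift_in:
  assumes "V \<in> U" "W \<in> U" "f \<in> V \<rightarrow>\<^sub>E car (mob P W)"
  shows "shift U P V W f \<in> plus1 V \<rightarrow>\<^sub>E car (mob P (plus1 W))"
  using assms monad_unit[of "plus1 W"]
  by (auto simp: shift_eq elim!: plus1_cases intro!: monad_sub_car[OF _ _ incl_unit])

end

section \<open>Iterated derivation and powers of the tautological module\<close>

primrec shiftn :: "'u monad \<Rightarrow> nat \<Rightarrow> 'u set \<Rightarrow> 'u set \<Rightarrow> ('u \<Rightarrow> 'u) \<Rightarrow> 'u \<Rightarrow> 'u" where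
  "shiftn P 0 V W f = f"
| "shiftn P (Suc n) V W f = shiftn P n (plus1 V) (plus1 W) (shift U P V W f)"

lemma shiftn_in:
  assumes "monad_on_Delta U P"
  shows "V \<in> U \<Longrightarrow> W \<in> U \<Longrightarrow> f \<in> V \<rightarrow>\<^sub>E car (mob P W) \<Longrightarrow>
    shiftn P n V W f \<in> (plus1 ^^ n) V \<rightarrow>\<^sub>E car (mob P ((plus1 ^^ n) W))"
  by (induction n arbitrary: V W f) (simp_all add: funpow_swap1[of plus1] shift_in[OF assms] del: PiE_iff)

lemma deriv_pow_ob: "V \<in> U \<Longrightarrow> modob ((deriv_module U P ^^ n) M) V = modob M ((plus1 ^^ n) V)"
  by (induction n arbitrary: V) (simp_all add: deriv_module_def funpow_swap1[of plus1])

text \<open>The outermost derivation shifts first and hands the shifted map to the remaining ones,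
  which is the order of recursion in \<open>shiftn\<close>.\<close>

lemma deriv_pow_sub:
  assumes "monad_on_Delta U P"
  shows "V \<in> U \<Longrightarrow> W \<in> U \<Longrightarrow> f \<in> V \<rightarrow>\<^sub>E car (mob P W) \<Longrightarrow>
    modsub ((deriv_module U P ^^ n) M) V W f = modsub M ((plus1 ^^ n) V) ((plus1 ^^ n) W) (shiftn P n V W f)"
proof (induction n arbitrary: V W f)
  case (Suc n)
  then show ?case
    by (simp add: deriv_module_def funpow_swap1[of plus1] monad_hom[OF assms] shift_in[OF assms] del: PiE_iff)
qed simp

lemma deriv_mor_pow: "V \<in> U \<Longrightarrow> (deriv_mor U ^^ n) \<rho> V = \<rho> ((plus1 ^^ n) V)"
  by (induction n arbitrary: V) (simp_all add: deriv_mor_def funpow_swap1[of plus1])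

text \<open>The argument lists of an operation of arity s before coding: by \<open>power_car\<close>
  their codes are the elements of the power module at V.\<close>

definition args :: "'u monad \<Rightarrow> arity \<Rightarrow> 'u set \<Rightarrow> 'u list \<Rightarrow> bool" where
  "args P s V = list_all2 (\<lambda>n x. x \<in> car (mob P ((plus1 ^^ n) V))) s"

lemma taut_simps [simp]: "modob (taut_module P) = mob P" "modsub (taut_module P) = msub P"
  by (simp_all add: taut_module_def)

lemma power_ob:
  "V \<in> U \<Longrightarrow> modob (power_module U P s (taut_module P)) V
     = preord_prod (map (\<lambda>n. mob P ((plus1 ^^ n) V)) s)"
  by (simp add: power_module_def prod_module_def deriv_pow_ob comp_def)

lemma car_preord_prod:
  "car (preord_prod (map p s)) = {tuple xs | xs :: 'u list. list_all2 (\<lambda>n x. x \<in> car (p n)) s xs}"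
  by (auto simp: preord_prod_def in_listset_iff list_all2_conv_all_nth image_iff)

lemma power_car:
  "V \<in> U \<Longrightarrow> car (modob (power_module U P s (taut_module P)) V) = {tuple xs | xs. args P s V xs}"
  by (simp add: power_ob car_preord_prod args_def)

lemma fun_prod_tuple:
  "tuple xs \<in> car (preord_prod ps) \<Longrightarrow> fun_prod ps fs (tuple xs) = tuple (map2 (\<lambda>f y. f y) fs xs :: 'u list)"
  by (simp add: fun_prod_def)

lemma map2_map_left: "map2 f (map g xs) ys = map2 (\<lambda>x. f (g x)) xs ys"
  by (induction xs arbitrary: ys; case_tac ys) auto

lemma power_sub:
  assumes "monad_on_Delta U P" "V \<in> U" "W \<in> U" "f \<in> V \<rightarrow>\<^sub>E car (mob P W)" "args P s V xs"
  shows "modsub (power_module U P s (taut_module P)) V W f (tuple xs) =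
    tuple (map2 (\<lambda>n. msub P ((plus1 ^^ n) V) ((plus1 ^^ n) W) (shiftn P n V W f)) s xs)"
proof -
  let ?ps = "map (\<lambda>n. mob P ((plus1 ^^ n) V)) s"
  have "tuple xs \<in> car (preord_prod ?ps)"
    using assms(5) by (simp add: car_preord_prod args_def)
  then have "fun_prod ?ps fs (tuple xs) = tuple (map2 (\<lambda>f y. f y) fs xs)" for fs
    by (rule fun_prod_tuple)
  then show ?thesis
    using assms by (simp add: power_module_def prod_module_def monad_hom comp_def deriv_pow_ob
        deriv_pow_sub map2_map_left del: PiE_iff)
qed

lemma power_mor_tuple:
  assumes "V \<in> U" "args P s V xs"
  shows "power_mor U P s (taut_module P) \<rho> V (tuple xs) = tuple (map2 (\<lambda>n. \<rho> ((plus1 ^^ n) V)) s xs)"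
proof -
  let ?ps = "map (\<lambda>n. mob P ((plus1 ^^ n) V)) s"
  have "tuple xs \<in> car (preord_prod ?ps)"
    using assms by (simp add: car_preord_prod args_def)
  then have "fun_prod ?ps fs (tuple xs) = tuple (map2 (\<lambda>f y. f y) fs xs)" for fs
    by (rule fun_prod_tuple)
  then show ?thesis
    using assms by (simp add: power_mor_def prod_mor_def comp_def deriv_pow_ob
        deriv_mor_pow map2_map_left)
qed

text \<open>Both composites are restricted to the carrier of the power at V, so the square commutes
  exactly if it does on every coded argument list.\<close>

lemma module_mor_power_iff:
  assumes m: "monad_on_Delta U P"
  shows "Delta_module_mor U P (PO U) (power_module U P s (taut_module P)) (taut_module P) \<rho> \<longleftrightarrow>
    \<rho> \<in> extensional U \<and>
    (\<forall>V\<in>U. \<rho> V \<in> hom (PO U) (preord_prod (map (\<lambda>n. mob P ((plus1 ^^ n) V)) s)) (mob P V)) \<and>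
    (\<forall>V\<in>U. \<forall>W\<in>U. \<forall>f\<in>V \<rightarrow>\<^sub>E car (mob P W). \<forall>xs. args P s V xs \<longrightarrow>
       \<rho> W (tuple (map2 (\<lambda>n. msub P ((plus1 ^^ n) V) ((plus1 ^^ n) W) (shiftn P n V W f)) s xs))
         = msub P V W f (\<rho> V (tuple xs)))"
proof -
  let ?M = "power_module U P s (taut_module P)"
  have sub: "cmp (PO U) (modob ?M V) (\<rho> W) (modsub ?M V W f) = cmp (PO U) (modob ?M V) (msub P V W f) (\<rho> V)
    \<longleftrightarrow> (\<forall>xs. args P s V xs \<longrightarrow>
       \<rho> W (tuple (map2 (\<lambda>n. msub P ((plus1 ^^ n) V) ((plus1 ^^ n) W) (shiftn P n V W f)) s xs))
         = msub P V W f (\<rho> V (tuple xs)))"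
    if "V \<in> U" "W \<in> U" "f \<in> V \<rightarrow>\<^sub>E car (mob P W)" for V W f
    using power_sub[OF m that]
    by (auto simp: PO_simps compose_def fun_eq_iff power_car[OF that(1)] restrict_def)
  have "\<rho> \<in> (\<Pi>\<^sub>E V\<in>U. hom (PO U) (modob ?M V) (mob P V)) \<longleftrightarrow> \<rho> \<in> extensional U \<and>
    (\<forall>V\<in>U. \<rho> V \<in> hom (PO U) (preord_prod (map (\<lambda>n. mob P ((plus1 ^^ n) V)) s)) (mob P V))"
    by (auto simp: PiE_iff power_ob)
  then show ?thesis
    unfolding module_mor_def SET_simps taut_simps by (simp add: sub monad_hom[OF m] del: PiE_iff)
qed

lemma rep_mor_iff:
  "rep_mor U S P Q f \<longleftrightarrow> monad_mor (SET U) (PO U) Delta (rmon P) (rmon Q) f \<and>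
     (\<forall>k\<in>ops S. \<forall>V\<in>U. \<forall>xs. args (rmon P) (ar S k) V xs \<longrightarrow>
        f V (rop P k V (tuple xs)) = rop Q k V (tuple (map2 (\<lambda>n. f ((plus1 ^^ n) V)) (ar S k) xs)))"
proof -
  let ?T = "taut_module (rmon P)"
  let ?Ts = "\<lambda>s. power_module U (rmon P) s ?T"
  have "module_cmp (SET U) (PO U) (?Ts s) f \<rho> = module_cmp (SET U) (PO U) (?Ts s) \<rho>' (power_mor U (rmon P) s ?T f)
    \<longleftrightarrow> (\<forall>V\<in>U. \<forall>xs. args (rmon P) s V xs \<longrightarrow>
        f V (\<rho> V (tuple xs)) = \<rho>' V (tuple (map2 (\<lambda>n. f ((plus1 ^^ n) V)) s xs)))" for s \<rho> \<rho>'
    unfolding module_cmp_def SET_simps PO_simps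
    by (auto simp: fun_eq_iff restrict_def compose_def power_car power_mor_tuple)
  then show ?thesis by (simp add: rep_mor_def Let_def)
qed

subsection \<open>Interpretation of terms in a representation\<close>

context
  fixes R :: "'u rep"
  assumes rep: "representation U S R"
begin

lemma rep_monad: "monad_on_Delta U (rmon R)"
  using rep by (simp add: representation_def)

lemma rep_op:
  assumes "k \<in> ops S"
  shows "Delta_module_mor U (rmon R) (PO U)
    (power_module U (rmon R) (ar S k) (taut_module (rmon R))) (taut_module (rmon R)) (rop R k)"
  using rep assms by (auto simp: representation_def)

lemma rop_hom:
  "k \<in> ops S \<Longrightarrow> V \<in> U \<Longrightarrow>
   rop R k V \<in> hom (PO U) (preord_prod (map (\<lambda>n. mob (rmon R) ((plus1 ^^ n) V)) (ar S k))) (mob (rmon R) V)"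
  using rep_op unfolding module_mor_power_iff[OF rep_monad] by blast

lemma rop_car:
  assumes "k \<in> ops S" "V \<in> U" "args (rmon R) (ar S k) V xs"
  shows "rop R k V (tuple xs) \<in> car (mob (rmon R) V)"
proof -
  have "rop R k V \<in> {tuple xs | xs. args (rmon R) (ar S k) V xs} \<rightarrow>\<^sub>E car (mob (rmon R) V)"
    using rop_hom[OF assms(1,2)] unfolding PO_simps car_preord_prod args_def by blast
  then show ?thesis using assms(3) by blast
qed

lemma rop_mono:
  assumes "k \<in> ops S" "V \<in> U" "length xs = length (ar S k)" "length ys = length (ar S k)"
    "\<And>i. i < length (ar S k) \<Longrightarrow> (xs ! i, ys ! i) \<in> ord (mob (rmon R) ((plus1 ^^ (ar S k ! i)) V))"
  shows "(rop R k V (tuple xs), rop R k V (tuple ys)) \<in> ord (mob (rmon R) V)"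
proof -
  have "(tuple xs, tuple ys) \<in> ord (preord_prod (map (\<lambda>n. mob (rmon R) ((plus1 ^^ n) V)) (ar S k)))"
    using assms by (auto simp: preord_prod_def)
  then show ?thesis using rop_hom[OF assms(1,2)] unfolding PO_simps by blast
qed

lemma rop_sub:
  "k \<in> ops S \<Longrightarrow> V \<in> U \<Longrightarrow> W \<in> U \<Longrightarrow> f \<in> V \<rightarrow>\<^sub>E car (mob (rmon R) W) \<Longrightarrow>
   args (rmon R) (ar S k) V xs \<Longrightarrow>
   rop R k W (tuple (map2 (\<lambda>n. msub (rmon R) ((plus1 ^^ n) V) ((plus1 ^^ n) W)
     (shiftn (rmon R) n V W f)) (ar S k) xs)) = msub (rmon R) V W f (rop R k V (tuple xs))"
  using rep_op unfolding module_mor_power_iff[OF rep_monad] by blast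

lemma interp_in: "wf_tm S V t \<Longrightarrow> V \<in> U \<Longrightarrow> interp S R V t \<in> car (mob (rmon R) V)"
proof (induction rule: wf_tm.induct)
  case (Var v V)
  then show ?case using monad_unit[OF rep_monad] by auto
next
  case (Op k V ts)
  show ?case
    using Op unfolding interp.simps
    by (intro rop_car) (auto simp: args_def intro!: list_all2_map2_right elim!: list_all2_mono)
qed

lemma interp_args:
  "V \<in> U \<Longrightarrow> list_all2 (\<lambda>n. wf_tm S ((plus1 ^^ n) V)) s ts \<Longrightarrow>
   args (rmon R) s V (map2 (\<lambda>n. interp S R ((plus1 ^^ n) V)) s ts)"
  unfolding args_def
  by (rule list_all2_map2_right) (erule list_all2_mono, simp add: interp_in)

lemma unit_ren_in:
  "W \<in> U \<Longrightarrow> r \<in> V \<rightarrow> W \<Longrightarrow> (\<lambda>v\<in>V. munit (rmon R) W (r v)) \<in> V \<rightarrow>\<^sub>E car (mob (rmon R) W)"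
  using monad_unit[OF rep_monad, of W] by auto

text \<open>By the unit law, weakening a variable in R gives a variable again; hence renamings
  remain renamings under binders.\<close>

lemma shift_unit_ren:
  assumes "V \<in> U" "W \<in> U" "r \<in> V \<rightarrow> W"
  shows "shift U (rmon R) V W (\<lambda>v\<in>V. munit (rmon R) W (r v))
    = (\<lambda>x\<in>plus1 V. munit (rmon R) (plus1 W) (ren_shift r x))"
  using assms
  by (auto simp: shift_eq[OF rep_monad] monad_sub_unit[OF rep_monad _ _ incl_unit[OF rep_monad]]
      Pi_iff intro!: restrict_ext elim!: plus1_cases)

lemma shiftn_unit_ren:
  "V \<in> U \<Longrightarrow> W \<in> U \<Longrightarrow> r \<in> V \<rightarrow> W \<Longrightarrow>
   shiftn (rmon R) n V W (\<lambda>v\<in>V. munit (rmon R) W (r v))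
     = (\<lambda>x\<in>(plus1 ^^ n) V. munit (rmon R) ((plus1 ^^ n) W) ((ren_shift ^^ n) r x))"
proof (induction n arbitrary: V W r)
  case (Suc n)
  have "ren_shift r \<in> plus1 V \<rightarrow> plus1 W" using ren_shift_wf[of r V W 1] Suc.prems by simp
  with Suc show ?case
    unfolding shiftn.simps shift_unit_ren[OF Suc.prems] funpow_Suc_right comp_apply
    by (intro Suc.IH) simp_all
qed simp

text \<open>This case precedes general substitution because the shift in \<open>shift_interp\<close>
  weakens interpretations in R, which must be recognised as interpretations of weakened
  terms.\<close>

lemma interp_ren:
  "wf_tm S V t \<Longrightarrow> V \<in> U \<Longrightarrow> W \<in> U \<Longrightarrow> r \<in> V \<rightarrow> W \<Longrightarrow>
   interp S R W (ren S r t) = msub (rmon R) V W (\<lambda>v\<in>V. munit (rmon R) W (r v)) (interp S R V t)"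
proof (induction arbitrary: W r rule: wf_tm.induct)
  case (Var v V)
  then show ?case by (simp add: monad_sub_unit[OF rep_monad _ _ unit_ren_in] del: restrict_apply) simp
next
  case (Op k V ts)
  have wf: "list_all2 (\<lambda>n. wf_tm S ((plus1 ^^ n) V)) (ar S k) ts"
    using Op.IH by (rule list_all2_mono) simp
  \<comment> \<open>The operation of R is a module morphism; read backwards, its law carries the
    substitution from the value to the arguments, where the induction hypothesis applies.\<close>
  show ?case
    unfolding interp.simps ren.simps rop_sub[OF Op.hyps(1) Op.prems(1,2) unit_ren_in[OF Op.prems(2,3)]
        interp_args[OF Op.prems(1) wf], symmetric] map2_map2_right
    by (rule arg_cong[where f = "\<lambda>xs. rop R k W (tuple xs)"])
       (auto dest!: list_all2_zipD[OF Op.IH] simp: shiftn_unit_ren Op.prems ren_shift_wf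
         simp del: restrict_apply)
qed

lemma interp_subst_in:
  "W \<in> U \<Longrightarrow> (\<And>v. v \<in> V \<Longrightarrow> wf_tm S W (f v)) \<Longrightarrow>
   (\<lambda>v\<in>V. interp S R W (f v)) \<in> V \<rightarrow>\<^sub>E car (mob (rmon R) W)"
  by (auto simp: interp_in)

lemma shift_interp:
  assumes "V \<in> U" "W \<in> U" "\<And>v. v \<in> V \<Longrightarrow> wf_tm S W (f v)"
  shows "shift U (rmon R) V W (\<lambda>v\<in>V. interp S R W (f v))
    = (\<lambda>x\<in>plus1 V. interp S R (plus1 W) (tm_shift S f x))"
  using assms
  by (auto simp: shift_eq[OF rep_monad] interp_ren[of W]
      Pi_iff intro!: restrict_ext elim!: plus1_cases)

lemma shiftn_interp:
  "V \<in> U \<Longrightarrow> W \<in> U \<Longrightarrow> (\<And>v. v \<in> V \<Longrightarrow> wf_tm S W (f v)) \<Longrightarrow>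
   shiftn (rmon R) n V W (\<lambda>v\<in>V. interp S R W (f v))
     = (\<lambda>x\<in>(plus1 ^^ n) V. interp S R ((plus1 ^^ n) W) ((tm_shift S ^^ n) f x))"
proof (induction n arbitrary: V W f)
  case (Suc n)
  have "wf_tm S (plus1 W) (tm_shift S f v)" if "v \<in> plus1 V" for v
    using tm_shift_wf[of V W f v 1] Suc.prems that by simp
  moreover have sh: "shift U (rmon R) V W (\<lambda>v\<in>V. interp S R W (f v))
    = (\<lambda>x\<in>plus1 V. interp S R (plus1 W) (tm_shift S f x))"
    by (rule shift_interp) (simp_all add: Suc.prems)
  ultimately show ?case
    unfolding shiftn.simps sh funpow_Suc_right comp_apply
    by (intro Suc.IH) (simp_all add: Suc.prems)
qed simp

text \<open>The induction is that of \<open>interp_ren\<close>, with \<open>shiftn_interp\<close>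
  under binders. The result gives both the monotonicity of substitution on terms and the monad
  morphism law for interpretations.\<close>

lemma interp_subst:
  "wf_tm S V t \<Longrightarrow> V \<in> U \<Longrightarrow> W \<in> U \<Longrightarrow> (\<And>v. v \<in> V \<Longrightarrow> wf_tm S W (f v)) \<Longrightarrow>
   interp S R W (subst S f t) = msub (rmon R) V W (\<lambda>v\<in>V. interp S R W (f v)) (interp S R V t)"
proof (induction arbitrary: W f rule: wf_tm.induct)
  case (Var v V)
  then show ?case by (simp add: monad_sub_unit[OF rep_monad _ _ interp_subst_in] del: restrict_apply) simp
next
  case (Op k V ts)
  have wf: "list_all2 (\<lambda>n. wf_tm S ((plus1 ^^ n) V)) (ar S k) ts"
    using Op.IH by (rule list_all2_mono) simp
  have f: "(\<lambda>v\<in>V. interp S R W (f v)) \<in> V \<rightarrow>\<^sub>E car (mob (rmon R) W)"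
    by (rule interp_subst_in) (simp_all add: Op.prems)
  show ?case
    unfolding interp.simps subst.simps rop_sub[OF Op.hyps(1) Op.prems(1,2) f interp_args[OF Op.prems(1) wf], symmetric] map2_map2_right
    by (rule arg_cong[where f = "\<lambda>xs. rop R k W (tuple xs)"])
       (auto dest!: list_all2_zipD[OF Op.IH] simp: shiftn_interp Op.prems tm_shift_wf[OF Op.prems(3)]
         simp del: restrict_apply)
qed

end

section \<open>The representation on terms\<close>

text \<open>The largest relation on terms over V for which the interpretations in all members of
  \<open>C\<close> are monotone; if \<open>C\<close> is empty, it relates all terms over V.\<close>

definition tm_ord :: "'u rep set \<Rightarrow> 'u set \<Rightarrow> 'u rel" where
  "tm_ord C V = {(enc s, enc t) | s t. wf_tm S V s \<and> wf_tm S V t \<and>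
     (\<forall>R\<in>C. (interp S R V s, interp S R V t) \<in> ord (mob (rmon R) V))}"

text \<open>Substitution is declared on a bare function space; \<open>tm_hom\<close> identifies this
  space with the hom-set out of \<open>fob Delta V\<close> once \<open>tm_ord\<close> is known to be
  a preorder.\<close>

definition tm_monad :: "'u rep set \<Rightarrow> 'u monad" where
  "tm_monad C = \<lparr>mob = (\<lambda>V\<in>U. \<lparr>car = terms V, ord = tm_ord C V\<rparr>),
     munit = (\<lambda>V\<in>U. \<lambda>v\<in>V. enc (Var v)),
     msub = (\<lambda>V\<in>U. \<lambda>W\<in>U. \<lambda>f\<in>V \<rightarrow>\<^sub>E terms W. \<lambda>x\<in>terms V. enc (subst S (\<lambda>v. dec (f v)) (dec x)))\<rparr>"

definition tm_rep :: "'u rep set \<Rightarrow> 'u rep" where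
  "tm_rep C = \<lparr>rmon = tm_monad C,
     rop = (\<lambda>k\<in>ops S. \<lambda>V\<in>U. \<lambda>x\<in>{tuple xs | xs. args (tm_monad C) (ar S k) V xs}.
       enc (Op k (map dec (untuple x))))\<rparr>"

text \<open>The set \<open>C\<close> affects only the order on terms and hence does not occur here;
  membership of R in \<open>C\<close> is what makes the map monotone.\<close>

definition tm_mor :: "'u rep \<Rightarrow> 'u family" where
  "tm_mor R = (\<lambda>V\<in>U. \<lambda>x\<in>terms V. interp S R V (dec x))"

lemma args_tm_monad:
  assumes "V \<in> U"
  shows "args (tm_monad C) s V xs \<longleftrightarrow>
    (\<exists>ts. xs = map enc ts \<and> list_all2 (\<lambda>n. wf_tm S ((plus1 ^^ n) V)) s ts)"
proof
  assume "args (tm_monad C) s V xs"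
  then have xs: "list_all2 (\<lambda>n x. x \<in> terms ((plus1 ^^ n) V)) s xs"
    using assms by (simp add: args_def tm_monad_def)
  then have "xs = map enc (map dec xs)"
    by (induction rule: list_all2_induct) (auto simp: terms_def)
  moreover have "list_all2 (\<lambda>n. wf_tm S ((plus1 ^^ n) V)) s (map dec xs)"
    using xs by (induction rule: list_all2_induct) (auto simp: terms_def)
  ultimately show "\<exists>ts. xs = map enc ts \<and> list_all2 (\<lambda>n. wf_tm S ((plus1 ^^ n) V)) s ts" by blast
qed (use assms in \<open>auto simp: args_def tm_monad_def list_all2_conv_all_nth\<close>)

section \<open>The term monad\<close>

context
  fixes C :: "'u rep set"
  assumes reps: "\<And>R. R \<in> C \<Longrightarrow> representation U S R"
begin

text \<open>An intersection of preorders pulled back along interpretations. Reflexivity uses that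
  well-formed terms are interpreted in the carrier.\<close>

lemma tm_ord_preorder: "V \<in> U \<Longrightarrow> preorder_on (terms V) (tm_ord C V)"
proof -
  assume V: "V \<in> U"
  have pre: "preorder_on (car (mob (rmon R) V)) (ord (mob (rmon R) V))" if "R \<in> C" for R
    using monad_preorder[OF rep_monad[OF reps[OF that]] V] .
  have refl: "(interp S R V t, interp S R V t) \<in> ord (mob (rmon R) V)" if "R \<in> C" "wf_tm S V t" for R t
    using pre[OF that(1)] interp_in[OF reps[OF that(1)] that(2) V]
    by (auto simp: preorder_on_def refl_on_def)
  have trans: "trans (ord (mob (rmon R) V))" if "R \<in> C" for R
    using pre[OF that] by (simp add: preorder_on_def)
  show ?thesis
    unfolding preorder_on_def
  proof (intro conjI)
    show "trans (tm_ord C V)"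
      unfolding trans_def[of "tm_ord C V"] by (auto simp: tm_ord_def) (meson transD[OF trans])
  qed (auto simp: tm_ord_def terms_def refl_on_def refl)
qed

lemma tm_mob [simp]: "V \<in> U \<Longrightarrow> mob (tm_monad C) V = \<lparr>car = terms V, ord = tm_ord C V\<rparr>"
  by (simp add: tm_monad_def)

lemma tm_munit [simp]: "V \<in> U \<Longrightarrow> munit (tm_monad C) V = (\<lambda>v\<in>V. enc (Var v))"
  by (simp add: tm_monad_def)

lemma tm_msub:
  "V \<in> U \<Longrightarrow> W \<in> U \<Longrightarrow> f \<in> V \<rightarrow>\<^sub>E terms W \<Longrightarrow>
   msub (tm_monad C) V W f = (\<lambda>x\<in>terms V. enc (subst S (\<lambda>v. dec (f v)) (dec x)))"
  by (simp add: tm_monad_def)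

lemma tm_msub_enc:
  "V \<in> U \<Longrightarrow> W \<in> U \<Longrightarrow> f \<in> V \<rightarrow>\<^sub>E terms W \<Longrightarrow> wf_tm S V t \<Longrightarrow>
   msub (tm_monad C) V W f (enc t) = enc (subst S (\<lambda>v. dec (f v)) t)"
  by (simp add: tm_msub)

lemma tm_hom: "W \<in> U \<Longrightarrow> hom (PO U) (fob Delta V) (mob (tm_monad C) W) = V \<rightarrow>\<^sub>E terms W"
  by (simp add: hom_Delta tm_ord_preorder)

lemma dec_fun_wf: "f \<in> V \<rightarrow>\<^sub>E terms W \<Longrightarrow> v \<in> V \<Longrightarrow> wf_tm S W (dec (f v))"
  by (auto dest!: PiE_mem dec_terms)

text \<open>For R in \<open>C\<close>, the interpretation of a substituted term is a fixed
  substitution map of R applied to the interpretation of the term, and that map is monotone.\<close>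

lemma tm_msub_hom:
  assumes "V \<in> U" "W \<in> U" "f \<in> V \<rightarrow>\<^sub>E terms W"
  shows "msub (tm_monad C) V W f \<in> hom (PO U) (mob (tm_monad C) V) (mob (tm_monad C) W)"
proof -
  let ?f = "\<lambda>v. dec (f v)"
  have wf: "wf_tm S W (subst S ?f t)" if "wf_tm S V t" for t
    using that dec_fun_wf[OF assms(3)] by (rule subst_wf)
  have "(interp S R W (subst S ?f s), interp S R W (subst S ?f t)) \<in> ord (mob (rmon R) W)"
    if "R \<in> C" "wf_tm S V s" "wf_tm S V t" "(interp S R V s, interp S R V t) \<in> ord (mob (rmon R) V)"
    for R s t
  proof -
    have "interp S R W (subst S ?f t)
      = msub (rmon R) V W (\<lambda>v\<in>V. interp S R W (?f v)) (interp S R V t)" if "wf_tm S V t" for t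
      by (rule interp_subst[OF reps[OF \<open>R \<in> C\<close>] that assms(1,2) dec_fun_wf[OF assms(3)]])
    moreover have "(\<lambda>v\<in>V. interp S R W (?f v)) \<in> V \<rightarrow>\<^sub>E car (mob (rmon R) W)"
      by (rule interp_subst_in[OF reps[OF \<open>R \<in> C\<close>] assms(2) dec_fun_wf[OF assms(3)]])
    ultimately show ?thesis
      using monad_sub_mono[OF rep_monad[OF reps[OF \<open>R \<in> C\<close>]] assms(1,2) _ that(4)] that(2,3) by simp
  qed
  then have "(enc (subst S ?f s), enc (subst S ?f t)) \<in> tm_ord C W" if "(enc s, enc t) \<in> tm_ord C V" for s t
    using that wf by (auto simp: tm_ord_def)
  then show ?thesis
    using assms wf by (auto simp: tm_msub PO_simps terms_def) (auto simp: tm_ord_def)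
qed

text \<open>The identity law comes from \<open>subst_Var\<close> and associativity from
  \<open>subst_subst\<close>; the rest is bookkeeping with codes and extensional functions.\<close>

lemma tm_monad_monad: "monad_on_Delta U (tm_monad C)"
  unfolding rel_monad_def SET_simps
proof (intro conjI ballI)
  let ?T = "tm_monad C"
  show "mob ?T \<in> U \<rightarrow>\<^sub>E obj (PO U)"
    using tm_ord_preorder terms_universe by (auto simp: tm_monad_def PO_simps)
  show "munit ?T \<in> (\<Pi>\<^sub>E c\<in>U. hom (PO U) (fob Delta c) (mob ?T c))"
    by (rule PiE_I) (auto simp: tm_hom simp del: tm_mob, auto simp: tm_monad_def)
  show "msub ?T \<in> (\<Pi>\<^sub>E c\<in>U. \<Pi>\<^sub>E d\<in>U. hom (PO U) (fob Delta c) (mob ?T d) \<rightarrow>\<^sub>E hom (PO U) (mob ?T c) (mob ?T d))"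
  proof (intro PiE_I)
    fix V W f
    assume "V \<in> U" "W \<in> U" "f \<in> hom (PO U) (fob Delta V) (mob ?T W)"
    then show "msub ?T V W f \<in> hom (PO U) (mob ?T V) (mob ?T W)"
      using tm_msub_hom tm_hom by blast
  next
    fix V W f
    assume "V \<in> U" "W \<in> U" "f \<notin> hom (PO U) (fob Delta V) (mob ?T W)"
    then have "f \<notin> V \<rightarrow>\<^sub>E terms W" using tm_hom by blast
    then show "msub ?T V W f = undefined"
      using \<open>V \<in> U\<close> \<open>W \<in> U\<close> unfolding tm_monad_def by simp
  qed (simp_all add: tm_monad_def)
  show "msub ?T V V (munit ?T V) = idn (PO U) (mob ?T V)" if "V \<in> U" for V
  proof -
    have "munit ?T V \<in> V \<rightarrow>\<^sub>E terms V" using that by auto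
    then show ?thesis
      using that by (auto simp: tm_msub PO_simps terms_def subst_Var intro!: restrict_ext)
  qed
  fix V W f
  assume V: "V \<in> U" and W: "W \<in> U" and "f \<in> hom (PO U) (fob Delta V) (mob ?T W)"
  then have f: "f \<in> V \<rightarrow>\<^sub>E terms W" using tm_hom by blast
  show "cmp (PO U) (fob Delta V) (msub ?T V W f) (munit ?T V) = f"
  proof
    fix v
    show "cmp (PO U) (fob Delta V) (msub ?T V W f) (munit ?T V) v = f v"
    proof (cases "v \<in> V")
      case True
      then show ?thesis
        using dec_terms[OF PiE_mem[OF f True]]
        by (simp add: PO_simps Delta_simps compose_eq V tm_msub_enc[OF V W f])
    next
      case False
      then show ?thesis
        using PiE_arb[OF f False] by (simp add: PO_simps Delta_simps compose_def)
    qed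
  qed
  fix X g
  assume X: "X \<in> U" and "g \<in> hom (PO U) (fob Delta W) (mob ?T X)"
  then have g: "g \<in> W \<rightarrow>\<^sub>E terms X" using tm_hom by blast
  let ?h = "compose V (msub ?T W X g) f"
  have h: "?h v = enc (subst S (\<lambda>v. dec (g v)) (dec (f v)))" if "v \<in> V" for v
    using that dec_terms[OF PiE_mem[OF f that]] tm_msub_enc[OF W X g, of "dec (f v)"]
    by (simp add: compose_def)
  have h': "?h \<in> V \<rightarrow>\<^sub>E terms X"
    using h subst_wf[OF dec_fun_wf[OF f] dec_fun_wf[OF g]] by (auto simp: compose_def)
  have eq: "msub ?T W X g (msub ?T V W f (enc t)) = msub ?T V X ?h (enc t)" if t: "wf_tm S V t" for t
  proof -
    have "msub ?T W X g (msub ?T V W f (enc t))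
        = enc (subst S (\<lambda>v. subst S (\<lambda>v. dec (g v)) (dec (f v))) t)"
      by (simp only: tm_msub_enc[OF V W f t] tm_msub_enc[OF W X g subst_wf[OF t dec_fun_wf[OF f]]]
          subst_subst)
    \<comment> \<open>Off V, where \<open>?h\<close> is undefined, the two substitutions may differ;
      a well-formed term over V does not see this.\<close>
    also have "subst S (\<lambda>v. subst S (\<lambda>v. dec (g v)) (dec (f v))) t = subst S (\<lambda>v. dec (?h v)) t"
      by (rule subst_cong[OF t]) (simp only: h dec_enc)
    finally show ?thesis by (simp only: tm_msub_enc[OF V X h' t])
  qed
  show "cmp (PO U) (mob ?T V) (msub ?T W X g) (msub ?T V W f)
      = msub ?T V X (cmp (PO U) (fob Delta V) (msub ?T W X g) f)"
  proof
    fix x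
    show "cmp (PO U) (mob ?T V) (msub ?T W X g) (msub ?T V W f) x
      = msub ?T V X (cmp (PO U) (fob Delta V) (msub ?T W X g) f) x"
    proof (cases "x \<in> terms V")
      case True
      then show ?thesis
        using eq[of "dec x"] dec_terms[OF True]
        by (simp add: PO_simps Delta_simps V compose_eq[of x "terms V"])
    next
      case False
      then show ?thesis
        using tm_msub[OF V X h'] by (simp add: PO_simps Delta_simps V compose_def[of "terms V"])
    qed
  qed
qed

text \<open>At \<open>incl v\<close> the functorial action of \<open>incl\<close> substitutes
  variables, which is renaming by \<open>ren_eq_subst\<close>; so the shift built from the monad is
  the syntactic one.\<close>

lemma tm_shift_eq:
  assumes "V \<in> U" "W \<in> U" "f \<in> V \<rightarrow>\<^sub>E terms W"
  shows "shift U (tm_monad C) V W f = (\<lambda>x\<in>plus1 V. enc (tm_shift S (\<lambda>v. dec (f v)) x))"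
  unfolding shift_eq[OF tm_monad_monad assms(1,2)]
proof (rule restrict_ext)
  fix x
  assume "x \<in> plus1 V"
  then show "(if x = star then munit (tm_monad C) (plus1 W) star else
      msub (tm_monad C) W (plus1 W) (\<lambda>w\<in>W. munit (tm_monad C) (plus1 W) (incl w)) (f (inv_into V incl x)))
    = enc (tm_shift S (\<lambda>v. dec (f v)) x)"
  proof (cases rule: plus1_cases)
    case 1
    then show ?thesis using assms by simp
  next
    case (2 v)
    let ?i = "\<lambda>w\<in>W. munit (tm_monad C) (plus1 W) (incl w)"
    have i: "?i \<in> W \<rightarrow>\<^sub>E terms (plus1 W)"
      using incl_unit[OF tm_monad_monad assms(2)] assms by simp
    have wf: "wf_tm S W (dec (f v))" using dec_fun_wf[OF assms(3) 2(1)] .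
    have "msub (tm_monad C) W (plus1 W) ?i (f v) = enc (subst S (\<lambda>w. dec (?i w)) (dec (f v)))"
      using tm_msub_enc[OF assms(2) _ i wf] assms dec_terms[OF PiE_mem[OF assms(3) 2(1)]] by simp
    also have "subst S (\<lambda>w. dec (?i w)) (dec (f v)) = ren S incl (dec (f v))"
      unfolding ren_eq_subst by (rule subst_cong[OF wf]) (simp add: assms)
    finally show ?thesis using 2 by (simp del: restrict_apply)
  qed
qed

lemma tm_shiftn_eq:
  "V \<in> U \<Longrightarrow> W \<in> U \<Longrightarrow> f \<in> V \<rightarrow>\<^sub>E terms W \<Longrightarrow>
   shiftn (tm_monad C) n V W f = (\<lambda>x\<in>(plus1 ^^ n) V. enc ((tm_shift S ^^ n) (\<lambda>v. dec (f v)) x))"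
proof (induction n arbitrary: V W f)
  case 0
  \<comment> \<open>Without any shift the claim is that coding cancels decoding on values in
    \<open>terms W\<close> and that f is undefined off V.\<close>
  show ?case
  proof
    fix x
    show "shiftn (tm_monad C) 0 V W f x
      = (\<lambda>x\<in>(plus1 ^^ 0) V. enc ((tm_shift S ^^ 0) (\<lambda>v. dec (f v)) x)) x"
      using dec_terms[OF PiE_mem[OF 0(3), of x]] PiE_arb[OF 0(3), of x] by (cases "x \<in> V") auto
  qed
next
  case (Suc n)
  let ?g = "\<lambda>x\<in>plus1 V. enc (tm_shift S (\<lambda>v. dec (f v)) x)"
  have g: "?g \<in> plus1 V \<rightarrow>\<^sub>E terms (plus1 W)"
    using tm_shift_wf[OF dec_fun_wf[OF Suc.prems(3)], where n = 1] by auto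
  have "shiftn (tm_monad C) (Suc n) V W f
      = (\<lambda>x\<in>(plus1 ^^ n) (plus1 V). enc ((tm_shift S ^^ n) (\<lambda>v. dec (?g v)) x))"
    unfolding shiftn.simps tm_shift_eq[OF Suc.prems]
    by (rule Suc.IH[OF _ _ g]) (simp_all add: Suc.prems)
  \<comment> \<open>The decoded \<open>?g\<close> matches the syntactic shift on
    \<open>plus1 V\<close>, and further shifts, restricted as here, depend on no other
    values.\<close>
  also have "\<dots> = (\<lambda>x\<in>(plus1 ^^ n) (plus1 V). enc ((tm_shift S ^^ n) (tm_shift S (\<lambda>v. dec (f v))) x))"
    by (intro restrict_ext arg_cong[where f = enc] tm_shift_cong[of "plus1 V"]) simp_all
  finally show ?case by (simp only: funpow_Suc_right comp_apply)
qed

section \<open>The operations on terms\<close>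

lemma tm_rep_simps [simp]: "rmon (tm_rep C) = tm_monad C"
  by (simp add: tm_rep_def)

lemma tm_rop:
  "k \<in> ops S \<Longrightarrow> V \<in> U \<Longrightarrow> list_all2 (\<lambda>n. wf_tm S ((plus1 ^^ n) V)) (ar S k) ts \<Longrightarrow>
   rop (tm_rep C) k V (tuple (map enc ts)) = enc (Op k ts)"
  by (auto simp: tm_rep_def args_tm_monad comp_def)

text \<open>Arguments related componentwise by \<open>tm_ord\<close> have related interpretations in
  each R of \<open>C\<close>, and the operation of R is monotone there.\<close>

lemma tm_rop_hom:
  assumes k: "k \<in> ops S" and V: "V \<in> U"
  shows "rop (tm_rep C) k V
    \<in> hom (PO U) (preord_prod (map (\<lambda>n. mob (tm_monad C) ((plus1 ^^ n) V)) (ar S k))) (mob (tm_monad C) V)"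
    (is "?r \<in> hom _ (preord_prod ?ps) _")
proof -
  have car: "car (preord_prod ?ps) = {tuple xs | xs. args (tm_monad C) (ar S k) V xs}"
    by (simp add: car_preord_prod args_def)
  have "?r \<in> car (preord_prod ?ps) \<rightarrow>\<^sub>E terms V"
  proof (rule PiE_I)
    fix x
    assume "x \<in> car (preord_prod ?ps)"
    then obtain ts where ts: "x = tuple (map enc ts)"
      "list_all2 (\<lambda>n. wf_tm S ((plus1 ^^ n) V)) (ar S k) ts"
      unfolding car by (auto simp: args_tm_monad[OF V])
    then show "?r x \<in> terms V" using k by (simp add: tm_rop[OF k V ts(2)] wf_tm_Op)
  next
    fix x
    assume "x \<notin> car (preord_prod ?ps)"
    then show "?r x = undefined" unfolding car using k V by (auto simp: tm_rep_def)
  qed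
  moreover have "(?r x, ?r y) \<in> tm_ord C V" if "(x, y) \<in> ord (preord_prod ?ps)" for x y
  proof -
    obtain xs ys where xy: "x = tuple xs" "y = tuple ys"
      and len: "length xs = length (ar S k)" "length ys = length (ar S k)"
      and ord: "\<And>i. i < length (ar S k) \<Longrightarrow> (xs ! i, ys ! i) \<in> tm_ord C ((plus1 ^^ (ar S k ! i)) V)"
      using \<open>(x, y) \<in> ord (preord_prod ?ps)\<close> V by (auto simp: preord_prod_def)
    \<comment> \<open>\<open>tm_ord\<close> relates only codes of well-formed terms, so both
      argument lists can be decoded.\<close>
    define ss where "ss = map dec xs"
    define ts where "ts = map dec ys"
    have wf: "list_all2 (\<lambda>n. wf_tm S ((plus1 ^^ n) V)) (ar S k) ss"
      "list_all2 (\<lambda>n. wf_tm S ((plus1 ^^ n) V)) (ar S k) ts"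
      using ord len by (fastforce simp: ss_def ts_def list_all2_conv_all_nth tm_ord_def)+
    have enc: "xs = map enc ss" "ys = map enc ts"
      using ord len by (fastforce simp: ss_def ts_def tm_ord_def intro!: nth_equalityI)+
    have "(interp S R V (Op k ss), interp S R V (Op k ts)) \<in> ord (mob (rmon R) V)" if "R \<in> C" for R
      unfolding interp.simps
    proof (rule rop_mono[OF reps[OF that] k V])
      fix i
      assume i: "i < length (ar S k)"
      with ord[OF i] len that show "(map2 (\<lambda>n. interp S R ((plus1 ^^ n) V)) (ar S k) ss ! i,
          map2 (\<lambda>n. interp S R ((plus1 ^^ n) V)) (ar S k) ts ! i)
        \<in> ord (mob (rmon R) ((plus1 ^^ (ar S k ! i)) V))"
        by (auto simp: tm_ord_def ss_def ts_def)
    qed (simp_all add: ss_def ts_def len)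
    then show ?thesis
      using wf k by (auto simp: xy enc tm_rop[OF k V] tm_ord_def wf_tm_Op)
  qed
  ultimately show ?thesis using V by (auto simp: PO_simps)
qed

text \<open>Substitution passes through \<open>Op\<close> by its defining equation; the work is to
  match \<open>shiftn\<close> of the term monad with the iterated \<open>tm_shift\<close> occurring
  there.\<close>

lemma tm_rep_representation: "representation U S (tm_rep C)"
proof -
  let ?T = "tm_monad C"
  have "Delta_module_mor U ?T (PO U) (power_module U ?T (ar S k) (taut_module ?T)) (taut_module ?T)
      (rop (tm_rep C) k)" if k: "k \<in> ops S" for k
    unfolding module_mor_power_iff[OF tm_monad_monad]
  proof (intro conjI ballI allI impI)
    show "rop (tm_rep C) k \<in> extensional U" using k by (simp add: tm_rep_def)
    fix V
    assume V: "V \<in> U"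
    show "rop (tm_rep C) k V \<in> hom (PO U)
        (preord_prod (map (\<lambda>n. mob ?T ((plus1 ^^ n) V)) (ar S k))) (mob ?T V)"
      by (rule tm_rop_hom[OF k V])
    fix W f xs
    assume W: "W \<in> U" and "f \<in> V \<rightarrow>\<^sub>E car (mob ?T W)" and xs: "args ?T (ar S k) V xs"
    then have f: "f \<in> V \<rightarrow>\<^sub>E terms W" by simp
    obtain ts where ts: "xs = map enc ts" "list_all2 (\<lambda>n. wf_tm S ((plus1 ^^ n) V)) (ar S k) ts"
      using xs args_tm_monad[OF V] by blast
    let ?g = "\<lambda>n. (tm_shift S ^^ n) (\<lambda>v. dec (f v))"
    have sub: "msub ?T ((plus1 ^^ n) V) ((plus1 ^^ n) W) (shiftn ?T n V W f) (enc t) = enc (subst S (?g n) t)"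
      if t: "wf_tm S ((plus1 ^^ n) V) t" for n t
    proof -
      have s: "shiftn ?T n V W f \<in> (plus1 ^^ n) V \<rightarrow>\<^sub>E terms ((plus1 ^^ n) W)"
        using shiftn_in[OF tm_monad_monad V W, of f n] f W by simp
      have "subst S (\<lambda>v. dec (shiftn ?T n V W f v)) t = subst S (?g n) t"
        by (rule subst_cong[OF t]) (simp add: tm_shiftn_eq[OF V W f])
      then show ?thesis using tm_msub_enc[OF _ _ s t] V W by simp
    qed
    have map: "map2 (\<lambda>n. msub ?T ((plus1 ^^ n) V) ((plus1 ^^ n) W) (shiftn ?T n V W f)) (ar S k) xs
      = map enc (map2 (\<lambda>n. subst S (?g n)) (ar S k) ts)"
      using ts(2) unfolding ts(1)
      by (induction rule: list_all2_induct) (simp_all add: sub)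
    have wf: "list_all2 (\<lambda>n. wf_tm S ((plus1 ^^ n) W)) (ar S k) (map2 (\<lambda>n. subst S (?g n)) (ar S k) ts)"
      using ts(2)
      by (intro list_all2_map2_right)
         (auto elim!: list_all2_mono intro!: subst_wf tm_shift_wf dec_fun_wf[OF f])
    show "rop (tm_rep C) k W (tuple (map2 (\<lambda>n. msub ?T ((plus1 ^^ n) V) ((plus1 ^^ n) W)
        (shiftn ?T n V W f)) (ar S k) xs)) = msub ?T V W f (rop (tm_rep C) k V (tuple xs))"
      unfolding map tm_rop[OF k W wf] unfolding ts(1) tm_rop[OF k V ts(2)]
      using ts(2) k by (simp add: tm_msub_enc[OF V W f] wf_tm_Op)
  qed
  then show ?thesis
    using tm_monad_monad by (auto simp: representation_def tm_rep_def)
qed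

section \<open>Interpretations as the only morphisms out of the terms\<close>

lemma tm_mor_enc: "V \<in> U \<Longrightarrow> wf_tm S V t \<Longrightarrow> tm_mor R V (enc t) = interp S R V t"
  by (simp add: tm_mor_def)

text \<open>Monotonicity is built into \<open>tm_ord\<close> because R belongs to \<open>C\<close>;
  the substitution law is \<open>interp_subst\<close>, and the law for operations is the recursion
  of \<open>interp\<close>.\<close>

lemma tm_mor_rep_mor:
  assumes R: "R \<in> C"
  shows "rep_mor U S (tm_rep C) R (tm_mor R)"
  unfolding rep_mor_iff tm_rep_simps
proof (intro conjI ballI allI impI)
  let ?T = "tm_monad C"
  note R = reps[OF R]
  have hom: "tm_mor R V \<in> hom (PO U) (mob ?T V) (mob (rmon R) V)" if "V \<in> U" for V
    using that \<open>R \<in> C\<close> interp_in[OF R] by (auto simp: PO_simps tm_mor_def terms_def) (auto simp: tm_ord_def)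
  show "monad_mor (SET U) (PO U) Delta ?T (rmon R) (tm_mor R)"
    unfolding monad_mor_def SET_simps
  proof (intro conjI ballI)
    show "tm_mor R \<in> (\<Pi>\<^sub>E V\<in>U. hom (PO U) (mob ?T V) (mob (rmon R) V))"
      using hom by (intro PiE_I) (simp_all add: tm_mor_def del: tm_mob)
    fix V
    assume V: "V \<in> U"
    show "cmp (PO U) (fob Delta V) (tm_mor R V) (munit ?T V) = munit (rmon R) V"
      using V monad_unit[OF rep_monad[OF R] V]
      by (auto simp: PO_simps Delta_simps compose_def fun_eq_iff tm_mor_enc restrict_def PiE_iff extensional_def)
    fix W f
    assume W: "W \<in> U" and "f \<in> hom (PO U) (fob Delta V) (mob ?T W)"
    then have f: "f \<in> V \<rightarrow>\<^sub>E terms W" using tm_hom by blast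
    have "cmp (PO U) (fob Delta V) (tm_mor R W) f = (\<lambda>v\<in>V. interp S R W (dec (f v)))"
      using W f by (auto simp: PO_simps Delta_simps compose_def tm_mor_def intro!: restrict_ext)
    moreover have "tm_mor R W (msub ?T V W f (enc t))
      = msub (rmon R) V W (\<lambda>v\<in>V. interp S R W (dec (f v))) (interp S R V t)" if t: "wf_tm S V t" for t
      using interp_subst[OF R t V W dec_fun_wf[OF f]] subst_wf[OF t dec_fun_wf[OF f]]
      by (simp add: tm_msub_enc[OF V W f t] tm_mor_enc W del: restrict_apply)
    ultimately show "cmp (PO U) (mob ?T V) (tm_mor R W) (msub ?T V W f)
      = cmp (PO U) (mob ?T V) (msub (rmon R) V W (cmp (PO U) (fob Delta V) (tm_mor R W) f)) (tm_mor R V)"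
      unfolding PO_simps using V
      by (auto simp: compose_def terms_def tm_mor_enc simp del: restrict_apply intro!: restrict_ext)
  qed
  fix k V xs
  assume k: "k \<in> ops S" and V: "V \<in> U" and "args ?T (ar S k) V xs"
  then obtain ts where ts: "xs = map enc ts" "list_all2 (\<lambda>n. wf_tm S ((plus1 ^^ n) V)) (ar S k) ts"
    using args_tm_monad[OF V] by blast
  have "map2 (\<lambda>n. tm_mor R ((plus1 ^^ n) V)) (ar S k) xs = map2 (\<lambda>n. interp S R ((plus1 ^^ n) V)) (ar S k) ts"
    using ts(2) unfolding ts(1) by (induction rule: list_all2_induct) (simp_all add: tm_mor_enc V)
  then show "tm_mor R V (rop (tm_rep C) k V (tuple xs))
    = rop R k V (tuple (map2 (\<lambda>n. tm_mor R ((plus1 ^^ n) V)) (ar S k) xs))"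
    using ts k by (simp add: tm_rop[OF k V] tm_mor_enc[OF V] wf_tm_Op)
qed

text \<open>Compatibility with units fixes g on variables, and compatibility with operations fixes
  it on all other terms. Off \<open>U\<close>, and off the codes of terms, both families are
  undefined.\<close>

lemma rep_mor_unique:
  assumes g: "rep_mor U S (tm_rep C) R g"
  shows "g = tm_mor R"
proof -
  let ?T = "tm_monad C"
  have mor: "monad_mor (SET U) (PO U) Delta ?T (rmon R) g"
    and op: "\<And>k V xs. k \<in> ops S \<Longrightarrow> V \<in> U \<Longrightarrow> args ?T (ar S k) V xs \<Longrightarrow>
      g V (rop (tm_rep C) k V (tuple xs)) = rop R k V (tuple (map2 (\<lambda>n. g ((plus1 ^^ n) V)) (ar S k) xs))"
    using g unfolding rep_mor_iff tm_rep_simps by blast+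
  have ext: "g \<in> (\<Pi>\<^sub>E V\<in>U. hom (PO U) (mob ?T V) (mob (rmon R) V))"
    and unit: "\<And>V. V \<in> U \<Longrightarrow> cmp (PO U) (fob Delta V) (g V) (munit ?T V) = munit (rmon R) V"
    using mor unfolding monad_mor_def SET_simps by blast+
  have eq: "g V (enc t) = interp S R V t" if "wf_tm S V t" "V \<in> U" for V t
    using that
  proof (induction rule: wf_tm.induct)
    case (Var v V)
    then show ?case
      using fun_cong[OF unit[of V], of v] by (simp add: PO_simps Delta_simps compose_eq)
  next
    case (Op k V ts)
    have wf: "list_all2 (\<lambda>n. wf_tm S ((plus1 ^^ n) V)) (ar S k) ts"
      using Op.IH by (rule list_all2_mono) simp
    have "map2 (\<lambda>n. g ((plus1 ^^ n) V)) (ar S k) (map enc ts) = map2 (\<lambda>n. interp S R ((plus1 ^^ n) V)) (ar S k) ts"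
      using Op.IH by (induction rule: list_all2_induct) (simp_all add: Op.prems)
    then show ?case
      using op[OF Op.hyps(1) Op.prems, of "map enc ts"] wf args_tm_monad[OF Op.prems]
      by (auto simp: tm_rop[OF Op.hyps(1) Op.prems wf])
  qed
  show ?thesis
  proof
    fix V
    show "g V = tm_mor R V"
    proof (cases "V \<in> U")
      case True
      then have "g V \<in> extensional (terms V)"
        using PiE_mem[OF ext True] by (auto simp: PO_simps PiE_def)
      then show ?thesis
        by (rule extensionalityI) (auto simp: tm_mor_def True eq terms_def)
    next
      case False
      then show ?thesis using PiE_arb[OF ext False] by (simp add: tm_mor_def)
    qed
  qed
qed

text \<open>The maps induced by the interpretations jointly reflect the order: for the tautological
  module by definition of \<open>tm_ord\<close>, for a derivative by evaluation at
  \<open>plus1 X\<close>, for a product componentwise. Softness of an inequation makes this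
  available for its codomain.\<close>

lemma algebraic_ord:
  assumes "algebraic U S M" "X \<in> U"
    and "u \<in> car (modob (smob M (tm_rep C)) X)" "v \<in> car (modob (smob M (tm_rep C)) X)"
    and "\<And>R. R \<in> C \<Longrightarrow> (smmor M (tm_rep C) R (tm_mor R) X u, smmor M (tm_rep C) R (tm_mor R) X v)
      \<in> ord (modob (smob M R) X)"
  shows "(u, v) \<in> ord (modob (smob M (tm_rep C)) X)"
  using assms
proof (induction arbitrary: X u v)
  case taut
  obtain s t where st: "u = enc s" "wf_tm S X s" "v = enc t" "wf_tm S X t"
    using taut(1-3) tm_rep_representation by (auto simp: taut_smodule_def REP_def terms_def)
  have "(interp S R X s, interp S R X t) \<in> ord (mob (rmon R) X)" if "R \<in> C" for R
    using taut(1) taut(4)[OF that] tm_mor_rep_mor[OF that] reps[OF that] tm_rep_representation st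
    by (simp add: taut_smodule_def REP_def tm_mor_enc)
  then show ?case
    using taut(1) tm_rep_representation st by (auto simp: taut_smodule_def REP_def tm_ord_def)
next
  case (deriv M)
  have "(u, v) \<in> ord (modob (smob M (tm_rep C)) (plus1 X))"
  proof (rule deriv.IH)
    fix R
    assume "R \<in> C"
    then show "(smmor M (tm_rep C) R (tm_mor R) (plus1 X) u, smmor M (tm_rep C) R (tm_mor R) (plus1 X) v)
      \<in> ord (modob (smob M R) (plus1 X))"
      using deriv.prems(1) deriv.prems(4)[of R] tm_mor_rep_mor[of R] reps[of R] tm_rep_representation
      by (simp add: deriv_smodule_def deriv_mor_def deriv_module_def REP_def)
  qed (use deriv.prems(1-3) tm_rep_representation in
      \<open>simp_all add: deriv_smodule_def deriv_module_def REP_def\<close>)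
  then show ?case
    using deriv.prems(1) tm_rep_representation
    by (simp add: deriv_smodule_def deriv_module_def REP_def)
next
  case (prod M N)
  let ?M = "modob (smob M (tm_rep C)) X" and ?N = "modob (smob N (tm_rep C)) X"
  have ob: "modob (smob (prod_smodule U S M N) Q) X = preord_prod [modob (smob M Q) X, modob (smob N Q) X]"
    if "representation U S Q" for Q
    using that prod.prems(1) by (simp add: prod_smodule_def prod_module_def REP_def)
  have car: "car (preord_prod [?M, ?N]) = {tuple [a, b] | a b. a \<in> car ?M \<and> b \<in> car ?N}"
    by (auto simp: preord_prod_def set_Cons_def image_iff)
  have ord: "(tuple [a, b], tuple [c, d]) \<in> ord (preord_prod [p, q]) \<longleftrightarrow> (a, c) \<in> ord p \<and> (b, d) \<in> ord q"
    for a b c d and p q :: "'u preord"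
    by (auto simp: preord_prod_def less_Suc_eq)
  obtain a b where u: "u = tuple [a, b]" "a \<in> car ?M" "b \<in> car ?N"
    using prod.prems(2) unfolding ob[OF tm_rep_representation] car by blast
  obtain c d where v: "v = tuple [c, d]" "c \<in> car ?M" "d \<in> car ?N"
    using prod.prems(3) unfolding ob[OF tm_rep_representation] car by blast
  have "(smmor M (tm_rep C) R (tm_mor R) X a, smmor M (tm_rep C) R (tm_mor R) X c) \<in> ord (modob (smob M R) X) \<and>
    (smmor N (tm_rep C) R (tm_mor R) X b, smmor N (tm_rep C) R (tm_mor R) X d) \<in> ord (modob (smob N R) X)"
    if R: "R \<in> C" for R
  proof -
    have "smmor (prod_smodule U S M N) (tm_rep C) R (tm_mor R) X (tuple [x, y])
      = tuple [smmor M (tm_rep C) R (tm_mor R) X x, smmor N (tm_rep C) R (tm_mor R) X y]"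
      if "x \<in> car ?M" "y \<in> car ?N" for x y
    proof -
      have "tuple [x, y] \<in> car (preord_prod [?M, ?N])" using that unfolding car by blast
      then show ?thesis
        using prod.prems(1) tm_mor_rep_mor[OF R] reps[OF R] tm_rep_representation
        by (simp add: prod_smodule_def prod_mor_def REP_def fun_prod_tuple)
    qed
    then show ?thesis
      using prod.prems(4)[OF R] u v unfolding ob[OF reps[OF R]] by (simp add: ord)
  qed
  then have "(a, c) \<in> ord ?M" "(b, d) \<in> ord ?N"
    using prod.IH(1)[OF prod.prems(1) u(2) v(2)] prod.IH(2)[OF prod.prems(1) u(3) v(3)] by blast+
  then show ?case unfolding ob[OF tm_rep_representation] u v by (simp add: ord)
qed

text \<open>By \<open>algebraic_ord\<close> it suffices to compare images in each R of
  \<open>C\<close>. Naturality turns these into the two half-equations of R at the image of y, where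
  R satisfies the inequation.\<close>

lemma tm_rep_satisfies:
  assumes "inequation U S a" "soft U S a" "\<And>R. R \<in> C \<Longrightarrow> satisfies U R a"
  shows "satisfies U (tm_rep C) a"
  unfolding satisfies_def
proof (intro ballI)
  fix X y
  assume X: "X \<in> U" and y: "y \<in> car (modob (smob (idom a) (tm_rep C)) X)"
  let ?T = "tm_rep C" and ?M = "idom a" and ?N = "icod a"
  have T: "?T \<in> obj (REP U S)" using tm_rep_representation by (simp add: REP_def)
  have car: "\<alpha> ?T X y \<in> car (modob (smob ?N ?T) X)"
    if "half_equation U S ?M ?N \<alpha>" for \<alpha>
  proof -
    have "Delta_module_mor U (rmon ?T) (PS U) (smob ?M ?T) (smob ?N ?T) (\<alpha> ?T)"
      using that T unfolding half_equation_def by blast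
    then have "\<alpha> ?T X \<in> car (modob (smob ?M ?T) X) \<rightarrow>\<^sub>E car (modob (smob ?N ?T) X)"
      using X unfolding module_mor_def SET_simps PS_simps by blast
    then show ?thesis using y by blast
  qed
  have half: "half_equation U S ?M ?N (lhs a)" "half_equation U S ?M ?N (rhs a)"
    using assms(1) by (simp_all add: inequation_def)
  show "(lhs a ?T X y, rhs a ?T X y) \<in> ord (modob (smob ?N ?T) X)"
  proof (rule algebraic_ord)
    fix R
    assume "R \<in> C"
    then have R: "R \<in> obj (REP U S)" and f: "tm_mor R \<in> hom (REP U S) ?T R"
      using reps tm_mor_rep_mor by (simp_all add: REP_def)
    have nat: "smmor ?N ?T R (tm_mor R) X (\<alpha> ?T X y) = \<alpha> R X (smmor ?M ?T R (tm_mor R) X y)"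
      if "half_equation U S ?M ?N \<alpha>" for \<alpha>
    proof -
      have "module_cmp (SET U) (PS U) (smob ?M ?T) (\<alpha> R) (smmor ?M ?T R (tm_mor R))
          = module_cmp (SET U) (PS U) (smob ?M ?T) (smmor ?N ?T R (tm_mor R)) (\<alpha> ?T)"
        using that T R f unfolding half_equation_def by blast
      from fun_cong[OF fun_cong[OF this, of X], of y] show ?thesis
        using X y by (simp add: module_cmp_def SET_simps PS_simps compose_eq)
    qed
    \<comment> \<open>The inequation holds in R at elements of its own domain module, so the image
      of y has to lie there; pullback keeps the object map.\<close>
    have "S_module U S ?M" using half(1) by (simp add: half_equation_def)
    then have "Delta_module_mor U (rmon ?T) (PS U) (smob ?M ?T)
        (Delta_pullback U (rmon ?T) (tm_mor R) (smob ?M R)) (smmor ?M ?T R (tm_mor R))"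
      using T R f unfolding S_module_def by blast
    then have "smmor ?M ?T R (tm_mor R) X \<in> car (modob (smob ?M ?T) X) \<rightarrow>\<^sub>E car (modob (smob ?M R) X)"
      using X unfolding module_mor_def SET_simps PS_simps pullback_def by auto
    then have "smmor ?M ?T R (tm_mor R) X y \<in> car (modob (smob ?M R) X)"
      using y by blast
    then show "(smmor ?N ?T R (tm_mor R) X (lhs a ?T X y), smmor ?N ?T R (tm_mor R) X (rhs a ?T X y))
        \<in> ord (modob (smob ?N R) X)"
      unfolding nat[OF half(1)] nat[OF half(2)]
      using assms(3)[OF \<open>R \<in> C\<close>] X by (simp add: satisfies_def)
  qed (use assms(2) X car half in \<open>simp_all add: soft_def\<close>)
qed

end

end

theorem theorem2p25:
  fixes U :: "'u set set" and S :: "'u sig" and A :: "'u ineq set"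
  assumes "universe U"
    and "signature U S"
    and "\<forall>a\<in>A. inequation U S a \<and> soft U S a"
  shows "\<exists>R. initial_object (REP_ineq U S A) R"
proof -
  interpret binding_signature U S using assms(1,2) by unfold_locales
  \<comment> \<open>\<open>?C\<close> comprises all representations of (S, A), and the construction
    over it yields a further member of \<open>?C\<close>; every member then receives exactly one
    morphism from it.\<close>
  let ?C = "{R. representation U S R \<and> (\<forall>a\<in>A. satisfies U R a)}"
  have "representation U S (tm_rep ?C)" "\<forall>a\<in>A. satisfies U (tm_rep ?C) a"
    using assms(3) by (auto intro!: tm_rep_representation tm_rep_satisfies)
  moreover have "rep_mor U S (tm_rep ?C) R f \<longleftrightarrow> f = tm_mor R" if "R \<in> ?C" for R f
    using tm_mor_rep_mor[of ?C, OF _ that] rep_mor_unique[of ?C] by blast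
  ultimately have "initial_object (REP_ineq U S A) (tm_rep ?C)"
    by (auto simp: initial_object_def REP_ineq_def full_subcat_def REP_def)
  then show ?thesis ..
qed

end
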